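(* Let $1\le p\le q<\infty$, $\varphi\in\mathcal{G}^{\rm dec}$ and $\rho:(0,\infty)\to(0,\infty)$. (i) If there exists a positive constant $A$ such that, for all $r\in(0,\infty)$, $$\Big(\sup_{0<t\le r}\rho(t)\Big)\varphi(r)^{1/p}\le A\,\varphi(r)^{1/q},\qquad( * )$$ then there exists a positive constant $C$ such that, for all $f\in L^{(p,\varphi)}(\mathbb{R}^n)$, $$M_\rho f(x)\le C\,Mf(x)^{p/q}\left(\|f\|_{L^{(p,\varphi)}}\right)^{1-p/q},\quad x\in\mathbb{R}^n.$$ Consequently, $M_\rho$ is bounded from $L^{(p,\varphi)}(\mathbb{R}^n)$ to $\mathrm{w}L^{(q,\varphi)}(\mathbb{R}^n)$. Moreover, if $p>1$, then, for all $f\in\mathrm{w}L^{(p,\varphi)}(\mathbb{R}^n)$, $$M_\rho f(x)\le C\,Mf(x)^{p/q}\left(\|f\|_{\mathrm{w}L^{(p,\varphi)}}\right)^{1-p/q},\quad x\in\mathbb{R}^n.$$ Consequently, if $p>1$, then $M_\rho$ is bounded from $L^{(p,\varphi)}(\mathbb{R}^n)$ to $L^{(q,\varphi)}(\mathbb{R}^n)$ and from $\mathrm{w}L^{(p,\varphi)}(\mathbb{R}^n)$ to $\mathrm{w}L^{(q,\varphi)}(\mathbb{R}^n)$. (ii) If $M_\rho$ is bounded from $L^{(p,\varphi)}(\mathbb{R}^n)$ to $\mathrm{w}L^{(q,\varphi)}(\mathbb{R}^n)$, then $( * )$ holds for some $A\in(0,\infty)$ and for all $r\in(0,\infty)$.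 (iii) In part (ii), the boundedness from $L^{(p,\varphi)}(\mathbb{R}^n)$ to $\mathrm{w}L^{(q,\varphi)}(\mathbb{R}^n)$ can be replaced by the boundedness from $L^{(p,\varphi)}(\mathbb{R}^n)$ to $L^{(1,\varphi^{1/q})}(\mathbb{R}^n)$; that is, if $M_\rho$ is bounded from $L^{(p,\varphi)}(\mathbb{R}^n)$ to $L^{(1,\varphi^{1/q})}(\mathbb{R}^n)$, then $( * )$ holds for some $A\in(0,\infty)$ and for all $r\in(0,\infty)$.
   Context: $|G|$ is the Lebesgue measure of $G\subset\mathbb{R}^n$; $B(a,r)$ is the open ball with center $a$ and radius $r$; $m(G,f,t)=|\{x\in G:|f(x)|>t\}|$. The generalized fractional maximal operator is $M_\rho f(x)=\sup_{B(a,r)\ni x}\rho(r)\frac1{|B(a,r)|}\int_{B(a,r)}|f(y)|\,dy$, supremum over all balls $B(a,r)$ containing $x$; $M$ is the Hardy-Littlewood maximal operator, i.e. $M_\rho$ with $\rho\equiv1$. No conditions on $\rho$ other than positivity are imposed. An operator $T$ is bounded from $X$ to $Y$ if there is a constant $C>0$ with $\|Tf\|_Y\le C\|f\|_X$ for all $f\in X$. $\mathcal{G}^{\rm dec}$ is the set of all $\varphi:(0,\infty)\to(0,\infty)$ for which there is $C>0$ such that $C\varphi(r)\ge\varphi(s)$ and $\varphi(r)r^n\le C\varphi(s)s^n$ whenever $0<r<s<\infty$. For $1\le p<\infty$ and $\varphi:(0,\infty)\to(0,\infty)$, the generalized Morrey space $L^{(p,\varphi)}(\mathbb{R}^n)$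 and generalized weak Morrey space $\mathrm{w}L^{(p,\varphi)}(\mathbb{R}^n)$ are the sets of measurable $f$ on $\mathbb{R}^n$ for which, respectively, $$\|f\|_{L^{(p,\varphi)}}=\sup_{B=B(a,r)}\Big(\frac1{\varphi(r)|B|}\int_B|f(x)|^p\,dx\Big)^{1/p},\quad \|f\|_{\mathrm{w}L^{(p,\varphi)}}=\sup_{B=B(a,r)}\ \sup_{t\in(0,\infty)}\Big(\frac{t^p\,m(B,f,t)}{\varphi(r)|B|}\Big)^{1/p}$$ is finite, suprema over all balls. $\varphi^{1/q}$ denotes $r\mapsto\varphi(r)^{1/q}$. *)

theory Defs
  imports "HOL-Analysis.Analysis"
begin

text \<open>
  Functions on \<open>\<real>\<^sup>n\<close> are extended-real-valued and Lebesgue measurable: a maximal function may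
  be infinite at some points, and this lets the maximal operators act between spaces of functions
  of one type.  Finiteness of any of the norms below makes a function finite almost everywhere.
  Norms and maximal functions are computed in \<^typ>\<open>ennreal\<close>, so that none of the suprema and
  integrals needs a side condition.  Weights are total functions on the reals of which only the
  values on \<open>(0,\<infinity>)\<close> matter.
\<close>

definition modulus :: "('a \<Rightarrow> ereal) \<Rightarrow> 'a \<Rightarrow> ennreal" where
  "modulus f x = e2ennreal \<bar>f x\<bar>"

text \<open>
  Powers of extended nonnegative reals, used for exponents \<open>a \<ge> 0\<close> only.  As \<open>0 powr 0 = 0\<close> for
  reals, the convention \<open>x\<^sup>0 = 1\<close> is imposed separately.
\<close>

definition epow :: "ennreal \<Rightarrow> real \<Rightarrow> ennreal" where
  "epow x a = (if a = 0 then 1 else if x = \<infinity> then \<infinity> else ennreal (enn2real x powr a))"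

definition G_dec :: "nat \<Rightarrow> (real \<Rightarrow> real) set" where
  "G_dec n = {\<phi>. (\<forall>r>0. \<phi> r > 0) \<and>
     (\<exists>C>0. \<forall>r s. 0 < r \<and> r < s \<longrightarrow> C * \<phi> r \<ge> \<phi> s \<and> \<phi> r * r ^ n \<le> C * (\<phi> s * s ^ n))}"

definition level_measure :: "(real ^ 'n) set \<Rightarrow> (real ^ 'n \<Rightarrow> ereal) \<Rightarrow> real \<Rightarrow> ennreal" where
  "level_measure G f t = emeasure lebesgue {x \<in> G. \<bar>f x\<bar> > ereal t}"

definition frac_maximal :: "(real \<Rightarrow> real) \<Rightarrow> (real ^ 'n \<Rightarrow> ereal) \<Rightarrow> real ^ 'n \<Rightarrow> ennreal" where
  "frac_maximal \<rho> f x =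
     (SUP (a, r) \<in> {(a, r). 0 < r \<and> x \<in> ball a r}.
        ennreal (\<rho> r) * ((\<integral>\<^sup>+y \<in> ball a r. modulus f y \<partial>lebesgue) / emeasure lebesgue (ball a r)))"

definition HL_maximal :: "(real ^ 'n \<Rightarrow> ereal) \<Rightarrow> real ^ 'n \<Rightarrow> ennreal" where
  "HL_maximal = frac_maximal (\<lambda>_. 1)"

definition frac_maximal_op :: "(real \<Rightarrow> real) \<Rightarrow> (real ^ 'n \<Rightarrow> ereal) \<Rightarrow> real ^ 'n \<Rightarrow> ereal" where
  "frac_maximal_op \<rho> f x = enn2ereal (frac_maximal \<rho> f x)"

definition morrey_norm :: "real \<Rightarrow> (real \<Rightarrow> real) \<Rightarrow> (real ^ 'n \<Rightarrow> ereal) \<Rightarrow> ennreal" where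
  "morrey_norm p \<phi> f =
     (SUP (a, r) \<in> {(a, r). 0 < r}.
        epow ((\<integral>\<^sup>+x \<in> ball a r. epow (modulus f x) p \<partial>lebesgue)
              / (ennreal (\<phi> r) * emeasure lebesgue (ball a r))) (1 / p))"

definition weak_morrey_norm :: "real \<Rightarrow> (real \<Rightarrow> real) \<Rightarrow> (real ^ 'n \<Rightarrow> ereal) \<Rightarrow> ennreal" where
  "weak_morrey_norm p \<phi> f =
     (SUP (a, r) \<in> {(a, r). 0 < r}. SUP t \<in> {0<..}.
        epow (ennreal (t powr p) * level_measure (ball a r) f t
              / (ennreal (\<phi> r) * emeasure lebesgue (ball a r))) (1 / p))"

definition morrey :: "real \<Rightarrow> (real \<Rightarrow> real) \<Rightarrow> (real ^ 'n \<Rightarrow> ereal) set" where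
  "morrey p \<phi> = {f \<in> borel_measurable lebesgue. morrey_norm p \<phi> f < \<infinity>}"

definition weak_morrey :: "real \<Rightarrow> (real \<Rightarrow> real) \<Rightarrow> (real ^ 'n \<Rightarrow> ereal) set" where
  "weak_morrey p \<phi> = {f \<in> borel_measurable lebesgue. weak_morrey_norm p \<phi> f < \<infinity>}"

definition bounded_operator ::
  "('f \<Rightarrow> 'g) \<Rightarrow> 'f set \<Rightarrow> ('f \<Rightarrow> ennreal) \<Rightarrow> 'g set \<Rightarrow> ('g \<Rightarrow> ennreal) \<Rightarrow> bool" where
  "bounded_operator T X norm_X Y norm_Y \<longleftrightarrow>
     (\<exists>C::real. C > 0 \<and> (\<forall>f\<in>X. T f \<in> Y \<and> norm_Y (T f) \<le> ennreal C * norm_X f))"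

text \<open>
  The supremum is taken in \<^typ>\<open>ennreal\<close>: if \<open>\<rho>\<close> is unbounded on some \<open>(0,r]\<close>, the condition fails.
\<close>

definition sup_condition ::
  "real \<Rightarrow> real \<Rightarrow> (real \<Rightarrow> real) \<Rightarrow> (real \<Rightarrow> real) \<Rightarrow> real \<Rightarrow> bool" where
  "sup_condition p q \<phi> \<rho> A \<longleftrightarrow>
     (\<forall>r>0. (SUP t\<in>{0<..r}. ennreal (\<rho> t)) * ennreal (\<phi> r powr (1 / p))
              \<le> ennreal (A * \<phi> r powr (1 / q)))"

end

(*
  Only an estimate of averages enters the pointwise inequality: if every ball B = B(a,r) satisfies
  |B|^{-1} int_B |f| <= K phi(r)^{1/p} N, then interpolating this bound with |B|^{-1} int_B |f| <= M f(x)
  with exponents 1 - p/q and p/q cancels the factor rho(r) phi(r)^{1/p - 1/q} <= A.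

  The boundedness statements then follow from that of M.  For x in B(a,r) and a level t exceeding a
  multiple of phi(r)^{1/p} N, the doubling property of phi excludes all balls of radius > r/2 from the
  supremum defining M f(x), so that the remaining ones lie in B(a,2r) and the Vitali covering lemma
  gives t |{x in B(a,r) : M f(x) > t}| <= C int_{B(a,2r), |f| > t/2} |f|.  Summing over dyadic levels
  replaces both the layer cake formula and Fubini's theorem.

  For the converse, f is the indicator of B(0,r): its norm is at most a multiple of phi(r)^{-1/p}, while
  M_rho f >= rho(t) on B(0,r) for all t <= r, because every point of B(0,r) lies in a ball of radius t
  contained in B(0,r).
*)

theory Submission
  imports Defs
begin

section \<open>Powers and dyadic sums in the extended nonnegative reals\<close>

text \<open>A Morrey function need not be globally integrable, so a global weak (1,1) inequality for
  M may have an infinite right-hand side. Every estimate is therefore localised to a ball and its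
  double, at the price that levels below a multiple of phi(r)^{1/p} N must be bounded trivially.
  Hence the constants for M are sums: one summand for low levels, one from the covering argument.

  Strong and weak spaces meet in the integrals of |f| over {|f| > s} within a ball B of radius r.
  These are at most \<kappa> s^{1-p} N^p phi(r) |B|, with \<kappa> = 1 in the strong case and
  \<kappa> = 2 / (1 - 2^{1-p}) in the weak case, where a geometric series of ratio 2^{1-p} forces p
  > 1. The strong type bound for M needs more: level bounds of order t^{-p} do not sum against t^p
  over dyadic t, so there the integrals over {|f| > s} are kept until after the summation.

  The heights at which f is split are multiples of N, so the estimates are made for N > 0, and
  functions of norm 0 are reached by a limit.\<close>

lemma epow_ennreal: "0 \<le> x \<Longrightarrow> 0 < a \<Longrightarrow> epow (ennreal x) a = ennreal (x powr a)"
  by (simp add: epow_def)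

lemma epow_top: "0 < a \<Longrightarrow> epow top a = top"
  by (simp add: epow_def)

lemma epow_0: "0 < a \<Longrightarrow> epow 0 a = 0"
  by (simp add: epow_def)

lemma epow_mono: "0 \<le> a \<Longrightarrow> x \<le> y \<Longrightarrow> epow x a \<le> epow y a"
  by (cases x; cases y) (auto simp: epow_def top_unique intro!: ennreal_leI powr_mono2)

lemma epow_le_ennreal_iff:
  assumes "0 < p" "0 \<le> y"
  shows "epow x (1 / p) \<le> ennreal y \<longleftrightarrow> x \<le> ennreal (y powr p)"
proof (cases x)
  case (real r)
  have r: "r = (r powr (1 / p)) powr p" using assms real by (simp add: powr_powr)
  have "r powr (1 / p) \<le> y \<longleftrightarrow> r \<le> y powr p"
    using assms by (subst (2) r) (auto simp: powr_mono2 dest: powr_less_mono2[of p y "r powr (1 / p)"] intro: leI)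
  with real assms show ?thesis
    by (simp add: epow_ennreal ennreal_le_iff)
qed (use assms in \<open>simp add: epow_top top_unique\<close>)

lemma epow_powr: "0 < a \<Longrightarrow> 0 < b \<Longrightarrow> epow (epow x a) b = epow x (a * b)"
  by (cases x) (auto simp: epow_ennreal epow_top powr_powr)

lemma epow_cmult: "0 < a \<Longrightarrow> 0 < c \<Longrightarrow> epow (ennreal c * x) a = ennreal (c powr a) * epow x a"
  by (cases x)
    (auto simp: epow_ennreal epow_top powr_mult ennreal_mult_top ennreal_mult'[symmetric])

lemma epow_measurable [measurable]:
  assumes [measurable]: "g \<in> borel_measurable M"
  shows "(\<lambda>x. epow (g x) a) \<in> borel_measurable M"
  unfolding epow_def by measurable

lemma div_ennreal_le_iff:
  assumes "0 < b"
  shows "x / ennreal b \<le> y \<longleftrightarrow> x \<le> y * ennreal b"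
proof
  assume "x / ennreal b \<le> y"
  then have "x / ennreal b * ennreal b \<le> y * ennreal b" by (rule mult_right_mono) simp
  then show "x \<le> y * ennreal b"
    using assms by (simp add: ennreal_divide_times divide_ennreal)
next
  assume "x \<le> y * ennreal b"
  then show "x / ennreal b \<le> y"
    using assms by (intro divide_le_posI_ennreal) (auto simp: mult.commute)
qed

text \<open>Lets a bound proved for all numbers above a norm pass to the norm itself, which may be 0
  and then gives no positive height at which to split a function.\<close>

lemma ennreal_le_cmult_of_gt:
  fixes x :: ennreal
  assumes "0 < C" "\<And>e. M < e \<Longrightarrow> x \<le> ennreal (C * e)"
  shows "x \<le> ennreal (C * M)"
proof (rule ennreal_le_epsilon)
  fix e :: real assume "0 < e"
  with assms(1) have "x \<le> ennreal (C * (M + e / C))" by (intro assms(2)) simp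
  also have "\<dots> = ennreal (C * M + e)" using assms by (simp add: distrib_left)
  also have "\<dots> \<le> ennreal (C * M) + ennreal e"
    using \<open>0 < e\<close> by (cases "0 \<le> C * M") (auto simp: ennreal_neg intro!: ennreal_leI)
  finally show "x \<le> ennreal (C * M) + ennreal e" .
qed

lemma ex_dyadic:
  assumes "0 < s" "s < x"
  shows "\<exists>k. 2 ^ k * s < x \<and> x \<le> 2 ^ Suc k * (s::real)"
proof -
  obtain m where "x / s < 2 ^ m" using real_arch_pow[of 2 "x / s"] by auto
  then have "x \<le> 2 ^ m * s" using assms by (simp add: field_simps)
  then obtain k where k: "x \<le> 2 ^ k * s" "\<And>j. j < k \<Longrightarrow> \<not> x \<le> 2 ^ j * s"
    using exists_least_iff[of "\<lambda>m. x \<le> 2 ^ m * s"] by blast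
  with assms obtain j where "k = Suc j" by (cases k) auto
  with k show ?thesis by force
qed

lemma ennreal_term_le_suminf: "F k \<le> suminf F" for F :: "nat \<Rightarrow> ennreal"
  using sum_le_suminf[of F "{k}"] by simp

text \<open>For finite x > s, the single term of the shell (2^k s, 2^{k+1} s] containing x already
  dominates x^p. The indicators are those of superlevel sets rather than of shells, so that the sum
  integrates termwise to measures of level sets.\<close>

lemma epow_indicator_le_dyadic_sum:
  assumes "0 < s" "0 < p"
  shows "epow x p * indicator {ennreal s<..} x
    \<le> (\<Sum>k. ennreal ((2 ^ Suc k * s) powr p) * indicator {ennreal (2 ^ k * s)<..} x)" (is "_ \<le> suminf ?F")
proof (cases x)
  case (real y)
  show ?thesis
  proof (cases "s < y")
    case True
    then obtain k where k: "2 ^ k * s < y" "y \<le> 2 ^ Suc k * s"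
      using ex_dyadic[OF assms(1)] by blast
    have "epow x p * indicator {ennreal s<..} x \<le> ?F k"
      using k assms real by (auto simp: epow_ennreal ennreal_less_iff indicator_def intro!: ennreal_leI powr_mono2)
    also have "\<dots> \<le> suminf ?F" by (rule ennreal_term_le_suminf)
    finally show ?thesis .
  qed (use real assms in \<open>simp add: ennreal_less_iff\<close>)
next
  case top
  \<comment> \<open>At infinity every indicator is 1, so it suffices that the coefficients are
    unbounded.\<close>
  have "ennreal M \<le> suminf ?F" for M
  proof -
    have "\<exists>k. M powr (1/p) / s < 2 ^ k" using real_arch_pow[of 2] by auto
    then obtain k where "M powr (1/p) / s < 2 ^ k" by blast
    then have "M powr (1/p) < 2 ^ k * s" using assms by (simp add: field_simps)
    also have "2 ^ k * s \<le> 2 ^ Suc k * s" using assms by simp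
    finally have "M powr (1/p) \<le> 2 ^ Suc k * s" by simp
    then have "(M powr (1/p)) powr p \<le> (2 ^ Suc k * s) powr p" using assms by (intro powr_mono2) auto
    then have "M \<le> (2 ^ Suc k * s) powr p" using assms
      by (cases "0 \<le> M") (auto simp: powr_powr intro: order_trans[of M 0])
    then have "ennreal M \<le> ?F k" using top by (simp add: ennreal_leI)
    also have "\<dots> \<le> suminf ?F" by (rule ennreal_term_le_suminf)
    finally show ?thesis .
  qed
  note * = this
  have "suminf ?F = top"
  proof (cases "suminf ?F")
    case (real M)
    then show ?thesis using *[of "M + 1"] by (simp add: ennreal_le_iff)
  qed
  then show ?thesis by simp
qed

lemma geometric_tail: "1 < p \<Longrightarrow> 0 < 1 - 2 powr (1 - p)" for p :: real
  using powr_less_mono[of "1 - p" 0 2] by simp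

text \<open>The levels below x form an increasing geometric progression of ratio 2^{p-1}, so their
  sum is comparable with its last term, which is at most x^{p-1}. The constant blows up as p tends
  to 1.\<close>

lemma dyadic_sum_le_epow:
  assumes "0 < s" "1 < p"
  shows "x * (\<Sum>k. ennreal ((2 ^ k * s) powr (p - 1)) * indicator {ennreal (2 ^ k * s)<..} x)
    \<le> ennreal (1 / (1 - 2 powr (1 - p))) * epow x p" (is "x * suminf ?F \<le> ennreal ?c * _")
proof (cases x)
  case top
  have "?c > 0" using geometric_tail assms by simp
  then show ?thesis using top assms by (simp add: epow_top ennreal_mult_top)
next
  case (real y)
  define d where "d = 2 powr (p - 1)"
  have d: "1 < d" "?c = d / (d - 1)"
    using assms geometric_tail[of p] powr_less_mono[of 0 "p-1" 2]
    by (auto simp: d_def powr_diff field_simps)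
  have c: "?c > 0" using geometric_tail assms by simp
  let ?f = "\<lambda>k::nat. (2 ^ k * s) powr (p - 1)"
  let ?g = "\<lambda>k::nat. if 2 ^ k * s < y then ?f k else 0"
  have f_Suc: "?f (Suc k) = d * ?f k" for k
    using assms by (simp add: d_def powr_mult)
  \<comment> \<open>The bound reproduces itself because 1 / (d - 1) + 1 = d / (d - 1) and the next
    term is d times the current one.\<close>
  have A: "(\<Sum>k<m. ?f k) \<le> ?f m / (d - 1)" for m
  proof (induction m)
    case 0 then show ?case using d by simp
  next
    case (Suc m)
    have "(\<Sum>k<Suc m. ?f k) \<le> ?f m / (d - 1) + ?f m" using Suc by simp
    also have "\<dots> = ?f (Suc m) / (d - 1)" unfolding f_Suc using d by (simp add: field_simps)
    finally show ?case .
  qed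
  \<comment> \<open>While 2^m s < y all earlier levels also lie below y, so the full geometric sum
    bounds the partial one; after that only zeros are added.\<close>
  have B: "(\<Sum>k<m. ?g k) \<le> ?c * y powr (p - 1)" for m
  proof (induction m)
    case 0 then show ?case using c by (simp add: mult_nonneg_nonneg del: d)
  next
    case (Suc m)
    show ?case
    proof (cases "2 ^ m * s < y")
      case True
      have "(\<Sum>k<Suc m. ?g k) \<le> (\<Sum>k<Suc m. ?f k)" by (rule sum_mono) auto
      also have "\<dots> \<le> ?f (Suc m) / (d - 1)" by (rule A)
      also have "\<dots> = ?c * ?f m" unfolding f_Suc d by simp
      also have "\<dots> \<le> ?c * y powr (p - 1)"
        using c True assms by (intro mult_left_mono powr_mono2) auto
      finally show ?thesis .
    qed (use Suc in simp)
  qed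
  have "suminf ?F \<le> ennreal (?c * y powr (p - 1))"
  proof (rule suminf_le_const)
    fix m
    have "sum ?F {..<m} = (\<Sum>k<m. ennreal (?g k))"
      using real assms by (intro sum.cong) (auto simp: indicator_def ennreal_less_iff)
    also have "\<dots> = ennreal (\<Sum>k<m. ?g k)" by (intro sum_ennreal) auto
    finally show "sum ?F {..<m} \<le> ennreal (?c * y powr (p - 1))"
      using B by (simp add: ennreal_leI)
  qed auto
  then have "x * suminf ?F \<le> ennreal y * ennreal (?c * y powr (p - 1))"
    using real by (intro mult_mono) auto
  also have "\<dots> = ennreal ?c * epow x p"
  proof (cases "y = 0")
    case False
    then have "y * (?c * y powr (p - 1)) = ?c * y powr p" using real by (simp add: powr_diff)
    then show ?thesis
      using real c assms by (simp add: epow_ennreal flip: ennreal_mult')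
  qed (use real assms in \<open>simp add: epow_0\<close>)
  finally show ?thesis .
qed

section \<open>Measures of balls\<close>

lemma
  fixes a :: "real ^ 'n"
  shows emeasure_ball_eq: "emeasure lebesgue (ball a r) = ennreal (measure lebesgue (ball a r))"
    and measure_ball_pos: "0 < r \<Longrightarrow> 0 < measure lebesgue (ball a r)"
proof -
  have "emeasure lborel (ball a r) \<noteq> \<infinity>" 
    by (metis emeasure_lborel_ball_finite less_irrefl infinity_ennreal_def)
  then show "emeasure lebesgue (ball a r) = ennreal (measure lebesgue (ball a r))"
    by (intro emeasure_eq_ennreal_measure) auto
  show "0 < measure lebesgue (ball a r)" if "0 < r"
    using that content_ball_pos[of r a] by simp
qed

lemma measure_ball_scale:
  fixes a b :: "real ^ 'n"
  assumes "0 \<le> r" "0 \<le> c"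
  shows "measure lebesgue (ball a (c * r)) = c ^ CARD('n) * measure lebesgue (ball b r)"
  using assms by (simp add: content_ball power_mult_distrib)

section \<open>A local weak type inequality for the maximal function\<close>

lemma modulus_measurable [measurable]:
  assumes [measurable]: "f \<in> borel_measurable M"
  shows "modulus f \<in> borel_measurable M"
  unfolding modulus_def by measurable

lemma less_modulus_iff: "0 \<le> t \<Longrightarrow> ennreal t < modulus f x \<longleftrightarrow> ereal t < \<bar>f x\<bar>"
  unfolding modulus_def
  by (cases "f x") (auto simp: ennreal_less_iff e2ennreal_infty ennreal_less_top simp flip: ennreal.abs_eq)

lemma modulus_frac_maximal_op [simp]: "modulus (frac_maximal_op \<rho> f) = frac_maximal \<rho> f"
  unfolding modulus_def frac_maximal_op_def by (auto simp: e2ennreal_enn2ereal)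

lemma level_measure_eq:
  "0 \<le> t \<Longrightarrow> level_measure G f t = emeasure lebesgue {x \<in> G. ennreal t < modulus f x}"
  unfolding level_measure_def by (simp add: less_modulus_iff)

lemma less_frac_maximal_iff:
  "t < frac_maximal \<rho> f x \<longleftrightarrow> (\<exists>a r. 0 < r \<and> x \<in> ball a r \<and>
     t < ennreal (\<rho> r) * ((\<integral>\<^sup>+y \<in> ball a r. modulus f y \<partial>lebesgue) / emeasure lebesgue (ball a r)))"
  unfolding frac_maximal_def by (auto simp: less_SUP_iff)

text \<open>The supremum runs over all balls containing x, not only over those centred at x, so the
  superlevel set is a union of open balls. This is the source of the measurability of the maximal
  functions.\<close>

lemma open_frac_maximal_gt: "open {x. t < frac_maximal \<rho> f x}"
proof -
  have "{x. t < frac_maximal \<rho> f x} = \<Union>{ball a r | a r. 0 < r \<and>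
     t < ennreal (\<rho> r) * ((\<integral>\<^sup>+y \<in> ball a r. modulus f y \<partial>lebesgue) / emeasure lebesgue (ball a r))}"
    unfolding less_frac_maximal_iff by blast
  also have "open \<dots>" by (rule open_Union) auto
  finally show ?thesis .
qed

lemma frac_maximal_measurable [measurable]: "frac_maximal \<rho> f \<in> borel_measurable lebesgue"
proof -
  have "frac_maximal \<rho> f \<in> borel_measurable borel"
    by (rule borel_measurableI_greater) (simp add: open_frac_maximal_gt)
  then show ?thesis by (auto intro: measurable_completion)
qed

lemma frac_maximal_op_measurable: "frac_maximal_op \<rho> f \<in> borel_measurable lebesgue"
  unfolding frac_maximal_op_def by measurable

lemma HL_maximal_measurable [measurable]: "HL_maximal f \<in> borel_measurable lebesgue"
  unfolding HL_maximal_def by (rule frac_maximal_measurable)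

lemma frac_maximal_ge:
  assumes "0 < r" "x \<in> ball a r"
  shows "ennreal (\<rho> r) * ((\<integral>\<^sup>+y \<in> ball a r. modulus f y \<partial>lebesgue) / emeasure lebesgue (ball a r))
    \<le> frac_maximal \<rho> f x"
  unfolding frac_maximal_def using assms by (intro SUP_upper2[of "(a, r)"]) auto

abbreviation tail :: "('a \<Rightarrow> ereal) \<Rightarrow> real \<Rightarrow> 'a \<Rightarrow> ennreal" where
  "tail f s x \<equiv> modulus f x * indicator {ennreal s<..} (modulus f x)"

lemma modulus_le_tail: "modulus f x \<le> ennreal s + tail f s x"
  by (cases "ennreal s < modulus f x") (auto simp: indicator_def add_increasing)

lemma ball_lebesgue_measurable [measurable]: "ball a r \<in> sets lebesgue"
  by auto

lemma set_nn_integral_le_tail: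
  fixes a :: "real ^ 'n"
  assumes [measurable]: "f \<in> borel_measurable lebesgue"
  shows "(\<integral>\<^sup>+x \<in> ball a r. modulus f x \<partial>lebesgue)
    \<le> ennreal s * emeasure lebesgue (ball a r) + (\<integral>\<^sup>+x \<in> ball a r. tail f s x \<partial>lebesgue)"
proof -
  have "(\<integral>\<^sup>+x \<in> ball a r. modulus f x \<partial>lebesgue)
      \<le> (\<integral>\<^sup>+x. ennreal s * indicator (ball a r) x + tail f s x * indicator (ball a r) x \<partial>lebesgue)"
    unfolding distrib_right[symmetric] by (intro nn_integral_mono mult_right_mono modulus_le_tail) auto
  also have "\<dots> = ennreal s * emeasure lebesgue (ball a r) + (\<integral>\<^sup>+x \<in> ball a r. tail f s x \<partial>lebesgue)"
    by (subst nn_integral_add) (measurable, simp add: nn_integral_cmult_indicator)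
  finally show ?thesis .
qed

text \<open>Replacing \<open>f\<close> by its part above \<open>t / 2\<close> costs at most \<open>t / 2\<close> in each average, hence a factor 2.\<close>

lemma HL_maximal_weak_type_ball:
  fixes f :: "real ^ 'n \<Rightarrow> ereal"
  assumes [measurable]: "f \<in> borel_measurable lebesgue"
    and "0 < t" "0 < r"
    and large: "\<And>b s. r / 2 < s \<Longrightarrow>
      (\<integral>\<^sup>+x \<in> ball b s. modulus f x \<partial>lebesgue) \<le> ennreal t * emeasure lebesgue (ball b s)"
  shows "ennreal t * emeasure lebesgue {x \<in> ball a r. ennreal t < HL_maximal f x}
    \<le> ennreal (2 * 5 ^ CARD('n)) * (\<integral>\<^sup>+x \<in> ball a (2 * r). tail f (t / 2) x \<partial>lebesgue)"
proof -
  let ?B = "\<lambda>i. ball (fst i) (snd i) :: (real ^ 'n) set"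
  let ?h = "tail f (t / 2)"
  define S where "S = {x \<in> ball a r. ennreal t < HL_maximal f x}"
  \<comment> \<open>Balls are encoded as pairs of centre and radius. The bound r / 2 on the radii
    serves twice: the covering lemma asks for bounded radii, and balls meeting B(a,r) stay inside
    B(a,2r).\<close>
  define K where "K = {i. 0 < snd i \<and> snd i \<le> r / 2 \<and> ?B i \<subseteq> ball a (2 * r) \<and>
    ennreal t * emeasure lebesgue (?B i) < (\<integral>\<^sup>+x \<in> ?B i. modulus f x \<partial>lebesgue)}"
  have "S \<subseteq> (\<Union>i\<in>K. ?B i)"
  proof
    fix x assume "x \<in> S"
    then obtain b s where bs: "0 < s" "x \<in> ball b s" "dist a x < r"
      "ennreal t < (\<integral>\<^sup>+y \<in> ball b s. modulus f y \<partial>lebesgue) / emeasure lebesgue (ball b s)"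
      by (auto simp: S_def HL_maximal_def less_frac_maximal_iff)
    then have *: "ennreal t * emeasure lebesgue (ball b s) < (\<integral>\<^sup>+y \<in> ball b s. modulus f y \<partial>lebesgue)"
      using measure_ball_pos[OF bs(1), of b] 
      by (simp add: emeasure_ball_eq not_le[symmetric] div_ennreal_le_iff)
    then have "s \<le> r / 2" using large[of s b] by (metis leD leI)
    moreover have "ball b s \<subseteq> ball a (2 * r)"
    proof
      fix y assume "y \<in> ball b s"
      then have "dist a y < r + (s + s)"
        using bs dist_triangle[of a y x] dist_triangle[of x y b] by (simp add: dist_commute)
      then show "y \<in> ball a (2 * r)" using \<open>s \<le> r / 2\<close> by simp
    qed
    ultimately show "x \<in> (\<Union>i\<in>K. ?B i)"
      using bs * by (intro UN_I[of "(b, s)"]) (auto simp: K_def)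
  qed
  moreover have "0 < snd i \<and> snd i \<le> r / 2" if "i \<in> K" for i using that by (auto simp: K_def)
  ultimately obtain C where C: "countable C" "C \<subseteq> K"
      "pairwise (\<lambda>i j. disjnt (?B i) (?B j)) C" "S \<subseteq> (\<Union>i\<in>C. ball (fst i) (5 * snd i))"
    by (rule Vitali_covering_lemma_balls)
  \<comment> \<open>On a selected ball the average of |f| exceeds t while the part of f below t / 2
    contributes at most t / 2, so the tail integral is at least half of t|B|. The constant is this
    factor 2 times the 5^n of the enlarged ball.\<close>
  have K: "ennreal t * emeasure lebesgue (ball (fst i) (5 * snd i))
      \<le> ennreal (2 * 5 ^ CARD('n)) * (\<integral>\<^sup>+x \<in> ?B i. ?h x \<partial>lebesgue)" if "i \<in> C" for i
  proof -
    define m where "m = measure lebesgue (?B i)"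
    have i: "0 < snd i" "ennreal t * ennreal m < (\<integral>\<^sup>+x \<in> ?B i. modulus f x \<partial>lebesgue)"
      using that C by (auto simp: K_def m_def emeasure_ball_eq)
    have "m \<ge> 0" by (simp add: m_def)
    have "ennreal (t * m) \<le> ennreal (t / 2 * m) + (\<integral>\<^sup>+x \<in> ?B i. ?h x \<partial>lebesgue)"
      using i(2) set_nn_integral_le_tail[OF assms(1), of "fst i" "snd i" "t / 2"]
        \<open>0 < t\<close> \<open>m \<ge> 0\<close> ennreal_mult'[of t m] ennreal_mult'[of "t / 2" m]
      by (simp add: emeasure_ball_eq flip: m_def)
    \<comment> \<open>Cancelling a summand is done in the reals, hence for a finite tail integral;
      for an infinite one the claim is trivial.\<close>
    then have "ennreal (t / 2 * m) \<le> (\<integral>\<^sup>+x \<in> ?B i. ?h x \<partial>lebesgue)"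
    proof (cases "\<integral>\<^sup>+x \<in> ?B i. ?h x \<partial>lebesgue")
      case (real H)
      assume "ennreal (t * m) \<le> ennreal (t / 2 * m) + (\<integral>\<^sup>+x \<in> ?B i. ?h x \<partial>lebesgue)"
      with real \<open>0 < t\<close> \<open>m \<ge> 0\<close> show ?thesis
        by (simp add: ennreal_le_iff flip: ennreal_plus)
    qed simp
    then have "ennreal (2 * 5 ^ CARD('n)) * ennreal (t / 2 * m)
        \<le> ennreal (2 * 5 ^ CARD('n)) * (\<integral>\<^sup>+x \<in> ?B i. ?h x \<partial>lebesgue)"
      by (rule mult_left_mono) simp
    moreover have "ennreal t * emeasure lebesgue (ball (fst i) (5 * snd i)) =
        ennreal (2 * 5 ^ CARD('n)) * ennreal (t / 2 * m)"
      using i(1) \<open>0 < t\<close> \<open>m \<ge> 0\<close> measure_ball_scale[of "snd i" 5 "fst i" "fst i"]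
      by (simp add: emeasure_ball_eq m_def mult_ac flip: ennreal_mult')
    ultimately show ?thesis by simp
  qed
  \<comment> \<open>Sums over the countable family are written as integrals over
    \<open>count_space C\<close>, so that exchanging sum and integral is a single rule, used once
    for the enlarged balls and once for the disjoint ones.\<close>
  have "emeasure lebesgue S \<le> (\<integral>\<^sup>+x. (\<integral>\<^sup>+i. indicator (ball (fst i) (5 * snd i)) x \<partial>count_space C) \<partial>lebesgue)"
  proof -
    have "S \<in> sets lebesgue" unfolding S_def by measurable
    then have "emeasure lebesgue S = (\<integral>\<^sup>+x. indicator S x \<partial>lebesgue)" by simp
    also have "\<dots> \<le> (\<integral>\<^sup>+x. (\<integral>\<^sup>+i. indicator (ball (fst i) (5 * snd i)) x \<partial>count_space C) \<partial>lebesgue)"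
    proof (rule nn_integral_mono)
      fix x
      show "indicator S x \<le> (\<integral>\<^sup>+i. indicator (ball (fst i) (5 * snd i)) x \<partial>count_space C)"
      proof (cases "x \<in> S")
        case True
        then obtain i where "i \<in> C" "x \<in> ball (fst i) (5 * snd i)" using C by blast
        with True show ?thesis
          using nn_integral_ge_point[of i C "\<lambda>i. indicator (ball (fst i) (5 * snd i)) x"] by auto
      qed simp
    qed
    finally show ?thesis .
  qed
  also have "\<dots> = (\<integral>\<^sup>+i. emeasure lebesgue (ball (fst i) (5 * snd i)) \<partial>count_space C)"
    using C by (subst nn_integral_count_space_nn_integral) auto
  finally have "ennreal t * emeasure lebesgue S
      \<le> ennreal t * (\<integral>\<^sup>+i. emeasure lebesgue (ball (fst i) (5 * snd i)) \<partial>count_space C)"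
    by (rule mult_left_mono) simp
  also have "\<dots> = (\<integral>\<^sup>+i. ennreal t * emeasure lebesgue (ball (fst i) (5 * snd i)) \<partial>count_space C)"
    by (simp add: nn_integral_cmult)
  also have "\<dots> \<le> (\<integral>\<^sup>+i. ennreal (2 * 5 ^ CARD('n)) * (\<integral>\<^sup>+x \<in> ?B i. ?h x \<partial>lebesgue) \<partial>count_space C)"
    using K by (intro nn_integral_mono) simp
  also have "\<dots> = ennreal (2 * 5 ^ CARD('n)) * (\<integral>\<^sup>+x. (\<integral>\<^sup>+i. ?h x * indicator (?B i) x \<partial>count_space C) \<partial>lebesgue)"
    using C(1) by (subst nn_integral_count_space_nn_integral) (assumption, measurable, simp add: nn_integral_cmult)
  also have "\<dots> \<le> ennreal (2 * 5 ^ CARD('n)) * (\<integral>\<^sup>+x \<in> ball a (2 * r). ?h x \<partial>lebesgue)"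
  proof (intro mult_left_mono nn_integral_mono)
    fix x
    show "(\<integral>\<^sup>+i. ?h x * indicator (?B i) x \<partial>count_space C) \<le> ?h x * indicator (ball a (2 * r)) x"
    proof (cases "\<exists>j\<in>C. x \<in> ?B j")
      case True
      then obtain j where j: "j \<in> C" "x \<in> ?B j" by blast
      then have "x \<in> ball a (2 * r)" using C(2) unfolding K_def by blast
      \<comment> \<open>By disjointness only the ball of index j contains x, and the sum over the
        family collapses to one term.\<close>
      have "indicator (?B i) x = (indicator {j} i :: ennreal)" if "i \<in> C" for i
        using C(3) j that by (cases "i = j") (auto simp: pairwise_def disjnt_iff)
      then have "(\<integral>\<^sup>+i. ?h x * indicator (?B i) x \<partial>count_space C) = (\<integral>\<^sup>+i. ?h x * indicator {j} i \<partial>count_space C)"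
        by (intro nn_integral_cong) simp
      also have "\<dots> = ?h x" using j by (subst nn_integral_cmult_indicator) auto
      finally show ?thesis using \<open>x \<in> ball a (2 * r)\<close> by simp
    next
      case False
      then have "(\<integral>\<^sup>+i. ?h x * indicator (?B i) x \<partial>count_space C) = (\<integral>\<^sup>+i. 0 \<partial>count_space C)"
        by (intro nn_integral_cong) auto
      then show ?thesis by simp
    qed
  qed simp
  finally show ?thesis by (simp add: S_def)
qed

section \<open>Morrey norms\<close>

lemma mult_le_ennreal_iff:
  assumes "0 < c" "0 \<le> d"
  shows "ennreal c * x \<le> ennreal d \<longleftrightarrow> x \<le> ennreal (d / c)"
proof (cases x)
  case (real y)
  with assms show ?thesis
    by (simp add: ennreal_le_iff pos_le_divide_eq mult.commute flip: ennreal_mult')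
qed (use assms in \<open>simp add: ennreal_mult_top top_unique\<close>)

lemma div_weight_le_iff:
  fixes a :: "real ^ 'n"
  assumes "0 < r" "0 < w" "0 \<le> y"
  shows "x / (ennreal w * emeasure lebesgue (ball a r)) \<le> ennreal y \<longleftrightarrow>
    x \<le> ennreal (y * w * measure lebesgue (ball a r))"
  using assms measure_ball_pos[OF assms(1), of a]
  by (simp add: emeasure_ball_eq div_ennreal_le_iff mult.assoc flip: ennreal_mult')

lemma SUP_ball_le_iff:
  fixes F :: "'a \<Rightarrow> real \<Rightarrow> ennreal"
  shows "(SUP (a, r) \<in> {(a, r). 0 < r}. F a r) \<le> y \<longleftrightarrow> (\<forall>a r. 0 < r \<longrightarrow> F a r \<le> y)"
  by (auto simp: SUP_le_iff)

text \<open>Later estimates work with this form, which is free of roots and of quotients of extended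
  reals.\<close>

lemma morrey_norm_le_iff:
  assumes "0 < p" "0 \<le> N" "\<And>r. 0 < r \<Longrightarrow> 0 < \<phi> r"
  shows "morrey_norm p \<phi> f \<le> ennreal N \<longleftrightarrow> (\<forall>a r. 0 < r \<longrightarrow>
    (\<integral>\<^sup>+x \<in> ball a r. epow (modulus f x) p \<partial>lebesgue)
      \<le> ennreal (N powr p * \<phi> r * measure lebesgue (ball a r)))"
proof -
  have "epow ((\<integral>\<^sup>+x \<in> ball a r. epow (modulus f x) p \<partial>lebesgue)
          / (ennreal (\<phi> r) * emeasure lebesgue (ball a r))) (1 / p) \<le> ennreal N \<longleftrightarrow>
      (\<integral>\<^sup>+x \<in> ball a r. epow (modulus f x) p \<partial>lebesgue)
        \<le> ennreal (N powr p * \<phi> r * measure lebesgue (ball a r))"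
    if "0 < r" for a r
    unfolding epow_le_ennreal_iff[OF assms(1,2)]
    by (rule div_weight_le_iff[OF that assms(3)[OF that] powr_ge_zero])
  then show ?thesis
    unfolding morrey_norm_def SUP_ball_le_iff by (intro iff_allI imp_cong refl)
qed

lemma morrey_normD:
  assumes "0 < p" "0 \<le> N" "\<And>r. 0 < r \<Longrightarrow> 0 < \<phi> r" "morrey_norm p \<phi> f \<le> ennreal N" "0 < r"
  shows "(\<integral>\<^sup>+x \<in> ball a r. epow (modulus f x) p \<partial>lebesgue)
    \<le> ennreal (N powr p * \<phi> r * measure lebesgue (ball a r))"
  by (rule morrey_norm_le_iff[THEN iffD1, rule_format]) (fact assms)+

lemma weak_morrey_norm_le_iff:
  assumes "0 < p" "0 \<le> N" "\<And>r. 0 < r \<Longrightarrow> 0 < \<phi> r"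
  shows "weak_morrey_norm p \<phi> f \<le> ennreal N \<longleftrightarrow> (\<forall>a r t. 0 < r \<longrightarrow> 0 < t \<longrightarrow>
    emeasure lebesgue {x \<in> ball a r. ennreal t < modulus f x}
      \<le> ennreal (N powr p * \<phi> r * measure lebesgue (ball a r) / t powr p))"
proof -
  have "epow (ennreal (t powr p) * level_measure (ball a r) f t
          / (ennreal (\<phi> r) * emeasure lebesgue (ball a r))) (1 / p) \<le> ennreal N \<longleftrightarrow>
      emeasure lebesgue {x \<in> ball a r. ennreal t < modulus f x}
        \<le> ennreal (N powr p * \<phi> r * measure lebesgue (ball a r) / t powr p)"
    if "0 < r" "0 < t" for a r t
    unfolding epow_le_ennreal_iff[OF assms(1,2)] level_measure_eq[OF less_imp_le[OF that(2)]]
      div_weight_le_iff[OF that(1) assms(3)[OF that(1)] powr_ge_zero]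
    using that assms(3)[OF that(1)] by (intro mult_le_ennreal_iff) (auto simp: less_imp_le)
  note * = this
  have SUP_greater: "(SUP t \<in> {0<..}. F t) \<le> y \<longleftrightarrow> (\<forall>t. 0 < t \<longrightarrow> F t \<le> y)" for F :: "real \<Rightarrow> ennreal" and y
    by (auto simp: SUP_le_iff)
  have all_imp: "(0 < r \<longrightarrow> (\<forall>t. P t)) \<longleftrightarrow> (\<forall>t. 0 < r \<longrightarrow> P t)" for r :: real and P :: "real \<Rightarrow> bool"
    by blast
  show ?thesis
    unfolding weak_morrey_norm_def SUP_ball_le_iff SUP_greater all_imp
    by (intro iff_allI imp_cong refl *)
qed

lemma weak_morrey_normD:
  assumes "0 < p" "0 \<le> N" "\<And>r. 0 < r \<Longrightarrow> 0 < \<phi> r" "weak_morrey_norm p \<phi> f \<le> ennreal N" "0 < r" "0 < t"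
  shows "emeasure lebesgue {x \<in> ball a r. ennreal t < modulus f x}
    \<le> ennreal (N powr p * \<phi> r * measure lebesgue (ball a r) / t powr p)"
  by (rule weak_morrey_norm_le_iff[THEN iffD1, rule_format]) (fact assms)+

text \<open>The only consequence of strong and weak Morrey bounds that the estimates of averages and
  of level sets of the maximal function need, so that both scales can be treated at once.\<close>

definition tail_bound :: "real \<Rightarrow> (real \<Rightarrow> real) \<Rightarrow> real \<Rightarrow> real \<Rightarrow> (real ^ 'n \<Rightarrow> ereal) \<Rightarrow> bool" where
  "tail_bound p \<phi> \<kappa> N f \<longleftrightarrow> (\<forall>a r s. 0 < r \<longrightarrow> 0 < s \<longrightarrow>
     (\<integral>\<^sup>+x \<in> ball a r. tail f s x \<partial>lebesgue)
       \<le> ennreal (\<kappa> * s powr (1 - p) * N powr p * \<phi> r * measure lebesgue (ball a r)))"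

text \<open>Chebyshev's inequality before integration: since 1 - p \<le> 0, the factor |f|^{1-p} is
  at most s^{1-p} wherever |f| > s.\<close>

lemma tail_le_epow:
  assumes "0 < s" "1 \<le> p"
  shows "tail f s x \<le> ennreal (s powr (1 - p)) * epow (modulus f x) p"
proof (cases "modulus f x")
  case (real y)
  show ?thesis
  proof (cases "s < y")
    case True
    have "y = y powr (1 - p) * y powr p" using True assms by (simp flip: powr_add)
    also have "\<dots> \<le> s powr (1 - p) * y powr p"
      using True assms by (intro mult_right_mono powr_mono2') auto
    finally show ?thesis using real assms
      by (auto simp: indicator_def epow_ennreal simp flip: ennreal_mult' intro!: ennreal_leI)
  qed (use real assms in \<open>simp add: ennreal_less_iff\<close>)
qed (use assms in \<open>simp add: epow_top ennreal_mult_top\<close>)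

lemma tail_bound_strong:
  fixes f :: "real ^ 'n \<Rightarrow> ereal"
  assumes [measurable]: "f \<in> borel_measurable lebesgue"
    and "1 \<le> p" "0 \<le> N" "\<And>r. 0 < r \<Longrightarrow> 0 < \<phi> r" "morrey_norm p \<phi> f \<le> ennreal N"
  shows "tail_bound p \<phi> 1 N f"
  unfolding tail_bound_def
proof (intro allI impI)
  fix a :: "real ^ 'n" and r s :: real assume "0 < r" "0 < s"
  have "(\<integral>\<^sup>+x \<in> ball a r. tail f s x \<partial>lebesgue)
      \<le> (\<integral>\<^sup>+x. ennreal (s powr (1 - p)) * (epow (modulus f x) p * indicator (ball a r) x) \<partial>lebesgue)"
    unfolding mult.assoc[symmetric]
    using \<open>0 < s\<close> assms by (intro nn_integral_mono mult_right_mono tail_le_epow) auto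
  also have "\<dots> = ennreal (s powr (1 - p)) * (\<integral>\<^sup>+x \<in> ball a r. epow (modulus f x) p \<partial>lebesgue)"
    by (rule nn_integral_cmult) measurable
  also have "\<dots> \<le> ennreal (s powr (1 - p)) * ennreal (N powr p * \<phi> r * measure lebesgue (ball a r))"
    using assms \<open>0 < r\<close> by (intro mult_left_mono morrey_normD) auto
  finally show "(\<integral>\<^sup>+x \<in> ball a r. tail f s x \<partial>lebesgue)
       \<le> ennreal (1 * s powr (1 - p) * N powr p * \<phi> r * measure lebesgue (ball a r))"
    by (simp add: mult.assoc flip: ennreal_mult')
qed

lemma epow_1 [simp]: "epow x 1 = x"
  by (cases x) (auto simp: epow_def)

lemma power_powr_commute: "(2 ^ k) powr a = (2 powr a) ^ k" for a :: real
  by (induction k) (simp_all add: powr_mult)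

text \<open>The dyadic sum with exponent 1 turns the tail into a series of level measures, and the
  weak bound makes its k-th term a multiple of (2^k s)^{1-p}. In the constant, 2 is the ratio
  between the ends of a dyadic shell and the rest is the sum of the geometric series.\<close>

lemma tail_bound_weak:
  fixes f :: "real ^ 'n \<Rightarrow> ereal"
  assumes [measurable]: "f \<in> borel_measurable lebesgue"
    and "1 < p" "0 \<le> N" "\<And>r. 0 < r \<Longrightarrow> 0 < \<phi> r" "weak_morrey_norm p \<phi> f \<le> ennreal N"
  shows "tail_bound p \<phi> (2 / (1 - 2 powr (1 - p))) N f"
  unfolding tail_bound_def
proof (intro allI impI)
  fix a :: "real ^ 'n" and r s :: real assume "0 < r" "0 < s"
  let ?B = "ball a r"
  define X where "X = N powr p * \<phi> r * measure lebesgue ?B"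
  have "0 \<le> X" using assms \<open>0 < r\<close> by (simp add: X_def less_imp_le)
  have sets: "{x \<in> ?B. ennreal t < modulus f x} \<in> sets lebesgue" for t
    by measurable
  have sum: "(\<lambda>k. 2 * s powr (1 - p) * X * (2 powr (1 - p)) ^ k) sums
      (2 * s powr (1 - p) * X * (1 / (1 - 2 powr (1 - p))))"
    using geometric_tail[OF \<open>1 < p\<close>] by (intro sums_mult geometric_sums) simp
  have le: "ennreal (2 ^ Suc k * s) * emeasure lebesgue {x \<in> ?B. ennreal (2 ^ k * s) < modulus f x}
      \<le> ennreal (2 * s powr (1 - p) * X * (2 powr (1 - p)) ^ k)" for k
  proof -
    let ?u = "2 ^ k * s"
    have "ennreal (2 * ?u) * emeasure lebesgue {x \<in> ?B. ennreal ?u < modulus f x}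
        \<le> ennreal (2 * ?u) * ennreal (X / ?u powr p)"
      unfolding X_def using assms \<open>0 < r\<close> \<open>0 < s\<close>
      by (intro mult_left_mono weak_morrey_normD) auto
    also have "\<dots> = ennreal (2 * X * (?u / ?u powr p))"
      using \<open>0 < s\<close> by (simp add: mult_ac flip: ennreal_mult')
    also have "?u / ?u powr p = ?u powr (1 - p)"
      using \<open>0 < s\<close> by (simp add: powr_diff)
    also have "\<dots> = (2 powr (1 - p)) ^ k * s powr (1 - p)"
      using \<open>0 < s\<close> by (simp add: powr_mult power_powr_commute)
    finally show ?thesis by (simp add: mult_ac)
  qed
  have "(\<integral>\<^sup>+x \<in> ?B. tail f s x \<partial>lebesgue)
      \<le> (\<integral>\<^sup>+x. (\<Sum>k. ennreal (2 ^ Suc k * s) * indicator {x \<in> ?B. ennreal (2 ^ k * s) < modulus f x} x) \<partial>lebesgue)"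
  proof (rule nn_integral_mono)
    fix x
    show "tail f s x * indicator ?B x \<le>
      (\<Sum>k. ennreal (2 ^ Suc k * s) * indicator {x \<in> ?B. ennreal (2 ^ k * s) < modulus f x} x)"
    proof (cases "x \<in> ?B")
      case True
      then have "indicator {x \<in> ?B. ennreal t < modulus f x} x = (indicator {ennreal t<..} (modulus f x) :: ennreal)" for t
        by (simp add: indicator_def)
      then show ?thesis
        using True epow_indicator_le_dyadic_sum[of s 1 "modulus f x"] \<open>0 < s\<close> by simp
    qed simp
  qed
  also have "\<dots> = (\<Sum>k. ennreal (2 ^ Suc k * s) * emeasure lebesgue {x \<in> ?B. ennreal (2 ^ k * s) < modulus f x})"
    using sets by (subst nn_integral_suminf)
      (intro borel_measurable_times_ennreal borel_measurable_const borel_measurable_indicator,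
       simp, intro suminf_cong nn_integral_cmult_indicator)
  also have "\<dots> \<le> (\<Sum>k. ennreal (2 * s powr (1 - p) * X * (2 powr (1 - p)) ^ k))"
    by (intro suminf_le le) auto
  also have "\<dots> = ennreal (2 * s powr (1 - p) * X * (1 / (1 - 2 powr (1 - p))))"
    using \<open>0 \<le> X\<close> by (intro suminf_ennreal_eq sum) auto
  finally show "(\<integral>\<^sup>+x \<in> ?B. tail f s x \<partial>lebesgue)
      \<le> ennreal (2 / (1 - 2 powr (1 - p)) * s powr (1 - p) * N powr p * \<phi> r * measure lebesgue ?B)"
    by (simp add: X_def mult_ac)
qed

lemma tail_bound_integral_le:
  fixes f :: "real ^ 'n \<Rightarrow> ereal"
  assumes "f \<in> borel_measurable lebesgue" "tail_bound p \<phi> \<kappa> N f"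
    and "0 < p" "0 < N" "0 \<le> \<kappa>" "0 < \<phi> r" "0 < r"
  shows "(\<integral>\<^sup>+x \<in> ball a r. modulus f x \<partial>lebesgue)
    \<le> ennreal ((1 + \<kappa>) * \<phi> r powr (1 / p) * N * measure lebesgue (ball a r))"
proof -
  \<comment> \<open>At this height \<open>s powr p = N powr p * \<phi> r\<close>, so the part of f
    below s and the tail above it are both bounded by multiples of s|B|, with factors 1 and
    \<kappa>.\<close>
  define s where "s = \<phi> r powr (1 / p) * N"
  define m where "m = measure lebesgue (ball a r)"
  have "0 < s" "0 \<le> m" using assms by (auto simp: s_def m_def)
  have "s powr p = N powr p * \<phi> r" using assms by (simp add: s_def powr_mult powr_powr)
  then have s: "\<kappa> * s powr (1 - p) * N powr p * \<phi> r * m = \<kappa> * s * m"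
    using \<open>0 < s\<close> assms by (simp add: powr_diff)
  have "(\<integral>\<^sup>+x \<in> ball a r. modulus f x \<partial>lebesgue)
      \<le> ennreal s * ennreal m + (\<integral>\<^sup>+x \<in> ball a r. tail f s x \<partial>lebesgue)"
    using set_nn_integral_le_tail[OF assms(1)] by (simp add: m_def emeasure_ball_eq)
  also have "\<dots> \<le> ennreal s * ennreal m + ennreal (\<kappa> * s powr (1 - p) * N powr p * \<phi> r * m)"
    using assms(2,7) \<open>0 < s\<close> by (intro add_left_mono) (simp add: tail_bound_def m_def)
  also have "\<dots> = ennreal ((1 + \<kappa>) * s * m)"
    unfolding s using \<open>0 < s\<close> \<open>0 \<le> m\<close> assms
    by (simp add: distrib_right flip: ennreal_mult' ennreal_plus)
  finally show ?thesis by (simp add: s_def m_def mult_ac)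
qed

section \<open>Doubling of the weight\<close>

lemma G_decE:
  assumes "\<phi> \<in> G_dec n"
  obtains C where "1 \<le> C" "\<And>r s. 0 < r \<Longrightarrow> r \<le> s \<Longrightarrow> \<phi> s \<le> C * \<phi> r"
    "\<And>r s. 0 < r \<Longrightarrow> r \<le> s \<Longrightarrow> \<phi> r * r ^ n \<le> C * (\<phi> s * s ^ n)"
proof -
  from assms obtain C where pos: "\<And>r. 0 < r \<Longrightarrow> 0 < \<phi> r"
    and C: "\<And>r s. 0 < r \<Longrightarrow> r < s \<Longrightarrow> \<phi> s \<le> C * \<phi> r"
      "\<And>r s. 0 < r \<Longrightarrow> r < s \<Longrightarrow> \<phi> r * r ^ n \<le> C * (\<phi> s * s ^ n)"
    unfolding G_dec_def by blast
  show thesis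
  \<comment> \<open>A constant of at least 1 covers the case r = s, which the strict inequality in
    \<open>G_dec\<close> leaves out.\<close>
  proof (rule that[of "max 1 C"])
    fix r s :: real assume rs: "0 < r" "r \<le> s"
    have mono: "z \<le> max 1 C * y" if "r < s \<Longrightarrow> z \<le> C * y" "r = s \<Longrightarrow> z = y" "0 \<le> y" for y z
    proof (cases "r = s")
      case True
      with that show ?thesis using mult_right_mono[of 1 "max 1 C" y] by simp
    next
      case False
      then have "z \<le> C * y" using that rs by simp
      also have "\<dots> \<le> max 1 C * y" using \<open>0 \<le> y\<close> by (intro mult_right_mono) auto
      finally show ?thesis .
    qed
    show "\<phi> s \<le> max 1 C * \<phi> r"
      by (rule mono) (use C rs pos[of r] in auto)
    show "\<phi> r * r ^ n \<le> max 1 C * (\<phi> s * s ^ n)"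
      by (rule mono) (use C rs pos[of s] in auto)
  qed simp
qed

text \<open>For s \<ge> r almost monotonicity of \<phi> suffices. For r / 2 < s < r the almost
  increasing function \<phi>(r) r^n loses at most (r / s)^n < 2^n, which is where
  \<open>C * 2 ^ n\<close> comes from.\<close>

lemma G_dec_doubling:
  assumes "\<phi> \<in> G_dec n"
  obtains D where "1 \<le> D" "\<And>r s. 0 < r \<Longrightarrow> r / 2 < s \<Longrightarrow> \<phi> s \<le> D * \<phi> r"
proof -
  have pos: "\<And>r. 0 < r \<Longrightarrow> 0 < \<phi> r" using assms by (simp add: G_dec_def)
  obtain C where C: "1 \<le> C" "\<And>r s. 0 < r \<Longrightarrow> r \<le> s \<Longrightarrow> \<phi> s \<le> C * \<phi> r"
    "\<And>r s. 0 < r \<Longrightarrow> r \<le> s \<Longrightarrow> \<phi> r * r ^ n \<le> C * (\<phi> s * s ^ n)"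
    using G_decE[OF assms] by metis
  show thesis
  proof (rule that[of "C * 2 ^ n"])
    show "1 \<le> C * 2 ^ n" using mult_mono[of 1 C 1 "2 ^ n"] C(1) by simp
    fix r s :: real assume rs: "0 < r" "r / 2 < s"
    show "\<phi> s \<le> C * 2 ^ n * \<phi> r"
    proof (cases "r \<le> s")
      case True
      then have "\<phi> s \<le> C * \<phi> r" using C rs by simp
      also have "\<dots> \<le> (C * 2 ^ n) * \<phi> r"
        using pos[OF rs(1)] C(1) by (intro mult_right_mono) auto
      finally show ?thesis .
    next
      case False
      then have "\<phi> s * s ^ n \<le> C * (\<phi> r * r ^ n)" using C(3)[of s r] rs by simp
      also have "\<dots> \<le> C * (\<phi> r * (2 * s) ^ n)"
        using rs pos[OF rs(1)] C(1) by (intro mult_left_mono power_mono) auto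
      also have "\<dots> = (C * 2 ^ n * \<phi> r) * s ^ n" by (simp add: power_mult_distrib)
      finally show ?thesis using rs by simp
    qed
  qed
qed

section \<open>The maximal function on Morrey spaces\<close>

text \<open>Averages over balls of radius s > r / 2 are at most (1 + \<kappa>) \<phi>(s)^{1/p} N,
  and doubling bounds this by the threshold imposed on t. Such balls therefore satisfy the
  hypothesis on large balls in the local weak type inequality.\<close>

lemma HL_maximal_level_le_large:
  fixes f :: "real ^ 'n \<Rightarrow> ereal"
  assumes meas: "f \<in> borel_measurable lebesgue" and tail: "tail_bound p \<phi> \<kappa> N f"
    and "1 \<le> p" "0 < N" "0 \<le> \<kappa>" "1 \<le> D"
    and pos: "\<And>r. 0 < r \<Longrightarrow> 0 < \<phi> r"
    and doubling: "\<And>r s. 0 < r \<Longrightarrow> r / 2 < s \<Longrightarrow> \<phi> s \<le> D * \<phi> r"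
    and "0 < r" and t: "(1 + \<kappa>) * (D * \<phi> r) powr (1 / p) * N \<le> t"
  shows "ennreal t * emeasure lebesgue {x \<in> ball a r. ennreal t < HL_maximal f x}
    \<le> ennreal (2 * 5 ^ CARD('n)) * (\<integral>\<^sup>+x \<in> ball a (2 * r). tail f (t / 2) x \<partial>lebesgue)"
proof (rule HL_maximal_weak_type_ball[OF meas _ \<open>0 < r\<close>])
  have "0 < (1 + \<kappa>) * (D * \<phi> r) powr (1 / p) * N"
    using assms(3-6) pos[OF \<open>0 < r\<close>] by (intro mult_pos_pos) auto
  with t show "0 < t" by simp
  fix b :: "real ^ 'n" and s assume s: "r / 2 < s"
  then have "0 < s" using \<open>0 < r\<close> by simp
  have "\<phi> s powr (1 / p) \<le> (D * \<phi> r) powr (1 / p)"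
    using \<open>1 \<le> p\<close> doubling[OF \<open>0 < r\<close> s] pos[OF \<open>0 < s\<close>] by (intro powr_mono2) auto
  then have "(1 + \<kappa>) * \<phi> s powr (1 / p) * N * measure lebesgue (ball b s)
      \<le> (1 + \<kappa>) * (D * \<phi> r) powr (1 / p) * N * measure lebesgue (ball b s)"
    using assms by (intro mult_right_mono mult_left_mono) auto
  also have "\<dots> \<le> t * measure lebesgue (ball b s)"
    using t by (intro mult_right_mono) auto
  finally have "ennreal ((1 + \<kappa>) * \<phi> s powr (1 / p) * N * measure lebesgue (ball b s))
      \<le> ennreal t * emeasure lebesgue (ball b s)"
    using \<open>0 < t\<close> by (simp add: emeasure_ball_eq ennreal_leI flip: ennreal_mult')
  moreover have "(\<integral>\<^sup>+x \<in> ball b s. modulus f x \<partial>lebesgue)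
      \<le> ennreal ((1 + \<kappa>) * \<phi> s powr (1 / p) * N * measure lebesgue (ball b s))"
    using assms \<open>0 < s\<close> by (intro tail_bound_integral_le) auto
  ultimately show "(\<integral>\<^sup>+x \<in> ball b s. modulus f x \<partial>lebesgue) \<le> ennreal t * emeasure lebesgue (ball b s)"
    by (rule order_trans[rotated])
qed

text \<open>Below the threshold L the measure of the whole ball is a sufficient bound, as t^p \<le>
  L^p; this gives the first summand of the constant. From L on the covering estimate applies with
  the tail at t / 2 on the doubled ball: 2 * 5^n comes from covering, 2^n from doubling the ball, (t
  / 2)^{1-p} from the tail, and D from \<phi>(2r) \<le> D \<phi>(r).\<close>

lemma HL_maximal_level_le:
  fixes f :: "real ^ 'n \<Rightarrow> ereal"
  assumes meas: "f \<in> borel_measurable lebesgue" and tail: "tail_bound p \<phi> \<kappa> N f"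
    and "1 \<le> p" "0 < N" "0 \<le> \<kappa>" "1 \<le> D"
    and pos: "\<And>r. 0 < r \<Longrightarrow> 0 < \<phi> r"
    and doubling: "\<And>r s. 0 < r \<Longrightarrow> r / 2 < s \<Longrightarrow> \<phi> s \<le> D * \<phi> r"
    and "0 < r" "0 < t"
  shows "emeasure lebesgue {x \<in> ball a r. ennreal t < HL_maximal f x}
    \<le> ennreal (((1 + \<kappa>) powr p * D + 2 powr p * 10 ^ CARD('n) * \<kappa> * D)
         * (N powr p * \<phi> r * measure lebesgue (ball a r)) / t powr p)"
    (is "_ \<le> ennreal ((?c1 + ?c2) * ?X / _)")
proof -
  define L where "L = (1 + \<kappa>) * (D * \<phi> r) powr (1 / p) * N"
  define m where "m = measure lebesgue (ball a r)"
  let ?S = "{x \<in> ball a r. ennreal t < HL_maximal f x}"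
  have "0 < \<phi> r" "0 < m" using pos \<open>0 < r\<close> measure_ball_pos by (auto simp: m_def)
  have "0 < L" unfolding L_def using assms(3-6) \<open>0 < \<phi> r\<close> by (intro mult_pos_pos) auto
  have Lp: "L powr p = ?c1 * N powr p * \<phi> r"
    using assms(3-6) \<open>0 < \<phi> r\<close> by (simp add: L_def powr_mult powr_powr)
  have c: "0 \<le> ?c1" "0 \<le> ?c2" "0 \<le> ?X" using assms(3-6) \<open>0 < \<phi> r\<close> by auto
  show ?thesis
  proof (cases "t < L")
    case True
    have "t powr p \<le> L powr p" using True assms by (intro powr_mono2) auto
    then have "m * t powr p \<le> ?c1 * ?X" using \<open>0 < m\<close> unfolding Lp by (simp add: m_def mult_ac)
    also have "\<dots> \<le> (?c1 + ?c2) * ?X" using c by (intro mult_right_mono) auto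
    finally have "m \<le> (?c1 + ?c2) * ?X / t powr p" using \<open>0 < t\<close> by (simp add: pos_le_divide_eq)
    moreover have "emeasure lebesgue ?S \<le> emeasure lebesgue (ball a r)"
      by (intro emeasure_mono) auto
    ultimately show ?thesis unfolding m_def emeasure_ball_eq
      by (meson ennreal_leI order_trans)
  next
    case False
    let ?Y = "\<kappa> * (t / 2) powr (1 - p) * N powr p * \<phi> (2 * r) * measure lebesgue (ball a (2 * r))"
    have "0 < \<phi> (2 * r)" using pos \<open>0 < r\<close> by simp
    have tp: "t powr p * (t / 2) powr (1 - p) = 2 powr p * (t / 2)"
      using \<open>0 < t\<close> by (simp add: powr_divide powr_diff)
    have ten: "(10 :: real) ^ CARD('n) = 5 ^ CARD('n) * 2 ^ CARD('n)"
      by (simp flip: power_mult_distrib)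
    have m2: "measure lebesgue (ball a (2 * r)) = 2 ^ CARD('n) * m"
      using measure_ball_scale[of r 2 a a] \<open>0 < r\<close> by (simp add: m_def)
    have "ennreal t * emeasure lebesgue ?S
        \<le> ennreal (2 * 5 ^ CARD('n)) * (\<integral>\<^sup>+x \<in> ball a (2 * r). tail f (t / 2) x \<partial>lebesgue)"
      using assms False by (intro HL_maximal_level_le_large[where \<phi> = \<phi> and D = D and \<kappa> = \<kappa>]) (auto simp: L_def)
    also have "\<dots> \<le> ennreal (2 * 5 ^ CARD('n)) * ennreal ?Y"
      using tail \<open>0 < t\<close> \<open>0 < r\<close> unfolding tail_bound_def by (intro mult_left_mono) auto
    also have "\<dots> = ennreal (2 * 5 ^ CARD('n) * ?Y)"
      by (simp flip: ennreal_mult')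
    finally have "emeasure lebesgue ?S \<le> ennreal (2 * 5 ^ CARD('n) * ?Y / t)"
      using \<open>0 < t\<close> \<open>0 < \<phi> (2 * r)\<close> assms(3-6) by (subst (asm) mult_le_ennreal_iff) auto
    also have "2 * 5 ^ CARD('n) * ?Y / t \<le> (?c1 + ?c2) * ?X / t powr p"
    proof -
      have "(2 * 5 ^ CARD('n) * ?Y / t) * t powr p
          = 2 * 5 ^ CARD('n) * 2 ^ CARD('n) * (t powr p * (t / 2) powr (1 - p)) / t * \<kappa> * \<phi> (2 * r) * N powr p * m"
        unfolding m2 by (simp add: mult_ac)
      also have "\<dots> = 2 powr p * 10 ^ CARD('n) * \<kappa> * \<phi> (2 * r) * N powr p * m"
        unfolding tp ten using \<open>0 < t\<close> by simp
      also have "\<dots> \<le> 2 powr p * 10 ^ CARD('n) * \<kappa> * (D * \<phi> r) * N powr p * m"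
        using assms \<open>0 < m\<close> by (intro mult_right_mono mult_left_mono doubling) auto
      also have "\<dots> = ?c2 * ?X" by (simp add: m_def mult_ac)
      also have "\<dots> \<le> (?c1 + ?c2) * ?X" using c by (intro mult_right_mono) auto
      finally show ?thesis using \<open>0 < t\<close> by (simp add: pos_le_divide_eq)
    qed
    finally show ?thesis by (simp add: ennreal_leI)
  qed
qed

text \<open>Values of M f up to L contribute at most L^p |B|. Above L, M f is decomposed along the
  levels 2^k L, each of which is large enough for the local weak type inequality. Summing the
  resulting tail integrals under the integral sign leaves a geometric sum at each point, which
  restores |f|^p.\<close>

lemma HL_maximal_strong_type:
  fixes f :: "real ^ 'n \<Rightarrow> ereal"
  assumes meas [measurable]: "f \<in> borel_measurable lebesgue" and norm: "morrey_norm p \<phi> f \<le> ennreal N"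
    and "1 < p" "0 < N" "1 \<le> D"
    and pos: "\<And>r. 0 < r \<Longrightarrow> 0 < \<phi> r"
    and doubling: "\<And>r s. 0 < r \<Longrightarrow> r / 2 < s \<Longrightarrow> \<phi> s \<le> D * \<phi> r"
    and "0 < r"
  shows "(\<integral>\<^sup>+x \<in> ball a r. epow (HL_maximal f x) p \<partial>lebesgue)
    \<le> ennreal ((2 powr p * D + 4 powr p * 10 ^ CARD('n) * (1 / (1 - 2 powr (1 - p))) * D)
         * (N powr p * \<phi> r * measure lebesgue (ball a r)))"
    (is "_ \<le> ennreal ((?c1 + ?c2) * ?X)")
proof -
  define L where "L = 2 * (D * \<phi> r) powr (1 / p) * N"
  \<comment> \<open>The weak type inequality at level 2^k L sees only the part of f above half that
    level, which is 2^k s.\<close>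
  define s where "s = L / 2"
  define m where "m = measure lebesgue (ball a r)"
  define g where "g = 1 / (1 - 2 powr (1 - p))"
  have "0 < g" using geometric_tail[OF \<open>1 < p\<close>] by (simp add: g_def)
  have "0 < \<phi> r" "0 < m" using pos \<open>0 < r\<close> measure_ball_pos by (auto simp: m_def)
  have "0 < L" unfolding L_def using assms(3-5) \<open>0 < \<phi> r\<close> by (intro mult_pos_pos) auto
  then have "0 < s" by (simp add: s_def)
  have Lp: "L powr p = 2 powr p * D * N powr p * \<phi> r"
    using assms(3-5) \<open>0 < \<phi> r\<close> by (simp add: L_def powr_mult powr_powr)
  have tail: "tail_bound p \<phi> 1 N f"
    using assms by (intro tail_bound_strong) auto
  let ?B = "ball a r" and ?B2 = "ball a (2 * r)"
  let ?S = "\<lambda>t. {x \<in> ?B. ennreal t < HL_maximal f x}"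
  let ?k = "ennreal (4 powr p * 5 ^ CARD('n))"
  have sets: "?S t \<in> sets lebesgue" for t by measurable
  have level: "ennreal ((2 ^ Suc k * L) powr p) * emeasure lebesgue (?S (2 ^ k * L))
      \<le> ?k * (ennreal ((2 ^ k * s) powr (p - 1)) * (\<integral>\<^sup>+x \<in> ?B2. tail f (2 ^ k * s) x \<partial>lebesgue))" for k
  proof -
    let ?u = "2 ^ k * L" and ?I = "\<integral>\<^sup>+x \<in> ?B2. tail f (2 ^ k * s) x \<partial>lebesgue"
    have "0 < ?u" using \<open>0 < L\<close> by simp
    have us: "?u = 2 * (2 ^ k * s)" by (simp add: s_def)
    have "1 * L \<le> ?u" using \<open>0 < L\<close> by (intro mult_right_mono) auto
    then have "ennreal ?u * emeasure lebesgue (?S ?u)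
        \<le> ennreal (2 * 5 ^ CARD('n)) * (\<integral>\<^sup>+x \<in> ?B2. tail f (?u / 2) x \<partial>lebesgue)"
      using assms tail by (intro HL_maximal_level_le_large[where \<phi> = \<phi> and D = D and \<kappa> = 1]) (auto simp: L_def)
    then have *: "ennreal ?u * emeasure lebesgue (?S ?u) \<le> ennreal (2 * 5 ^ CARD('n)) * ?I"
      by (simp add: s_def)
    \<comment> \<open>One factor \<open>?u\<close> is split off to be absorbed by the weak type
      inequality; the remaining power p - 1 is the weight in the final geometric sum. Rewriting it
      in terms of 2^k s yields 2^p * 2^{p-1} * 2 = 4^p.\<close>
    have "ennreal ((2 ^ Suc k * L) powr p) = ennreal (2 powr p * ?u powr (p - 1)) * ennreal ?u"
      using \<open>0 < ?u\<close> \<open>0 < L\<close> by (simp add: powr_diff powr_mult mult_ac flip: ennreal_mult')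
    then have "ennreal ((2 ^ Suc k * L) powr p) * emeasure lebesgue (?S ?u)
        = ennreal (2 powr p * ?u powr (p - 1)) * (ennreal ?u * emeasure lebesgue (?S ?u))"
      by (simp add: mult.assoc)
    also have "\<dots> \<le> ennreal (2 powr p * ?u powr (p - 1)) * (ennreal (2 * 5 ^ CARD('n)) * ?I)"
      using * by (rule mult_left_mono) simp
    also have "\<dots> = ennreal (2 powr p * ?u powr (p - 1) * (2 * 5 ^ CARD('n))) * ?I"
      by (simp add: mult.assoc[symmetric] flip: ennreal_mult')
    also have "2 powr p * ?u powr (p - 1) * (2 * 5 ^ CARD('n))
        = (4 powr p * 5 ^ CARD('n)) * (2 ^ k * s) powr (p - 1)"
    proof -
      have "?u powr (p - 1) = 2 powr p / 2 * (2 ^ k * s) powr (p - 1)"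
        unfolding us using \<open>0 < s\<close> by (subst powr_mult) (auto simp: powr_diff)
      moreover have "4 powr p = 2 powr p * (2 powr p :: real)"
        by (simp flip: powr_mult)
      ultimately show ?thesis by simp
    qed
    finally show ?thesis by (simp add: ennreal_mult' mult.assoc)
  qed
  have "(\<integral>\<^sup>+x \<in> ?B. epow (HL_maximal f x) p \<partial>lebesgue)
      \<le> (\<integral>\<^sup>+x. ennreal (L powr p) * indicator ?B x
          + (\<Sum>k. ennreal ((2 ^ Suc k * L) powr p) * indicator (?S (2 ^ k * L)) x) \<partial>lebesgue)"
  proof (rule nn_integral_mono)
    fix x
    show "epow (HL_maximal f x) p * indicator ?B x \<le> ennreal (L powr p) * indicator ?B x
        + (\<Sum>k. ennreal ((2 ^ Suc k * L) powr p) * indicator (?S (2 ^ k * L)) x)" (is "_ \<le> _ + ?R")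
    proof (cases "x \<in> ?B")
      case True
      show ?thesis
      proof (cases "ennreal L < HL_maximal f x")
        case False
        then have "epow (HL_maximal f x) p \<le> epow (ennreal L) p"
          using assms by (intro epow_mono) auto
        also have "\<dots> = ennreal (L powr p)" using assms \<open>0 < L\<close> by (simp add: epow_ennreal)
        finally show ?thesis using True by (simp add: add_increasing2)
      next
        case large: True
        have "indicator (?S t) x = (indicator {ennreal t<..} (HL_maximal f x) :: ennreal)" for t
          using True by (simp add: indicator_def)
        then have "epow (HL_maximal f x) p \<le> ?R"
          using large epow_indicator_le_dyadic_sum[of L p "HL_maximal f x"] assms \<open>0 < L\<close> by simp
        then show ?thesis using True by (simp add: add_increasing)
      qed
    qed simp
  qed
  also have "\<dots> = ennreal (L powr p) * emeasure lebesgue ?B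
      + (\<Sum>k. ennreal ((2 ^ Suc k * L) powr p) * emeasure lebesgue (?S (2 ^ k * L)))"
  proof -
    have m: "(\<lambda>x. ennreal ((2 ^ Suc k * L) powr p) * indicator (?S (2 ^ k * L)) x) \<in> borel_measurable lebesgue" for k
      using sets by (intro borel_measurable_times_ennreal borel_measurable_const borel_measurable_indicator)
    show ?thesis
      using sets m by (subst nn_integral_add)
        (auto intro!: borel_measurable_suminf_order suminf_cong
          simp: nn_integral_suminf nn_integral_cmult_indicator simp del: power_Suc)
  qed
  also have "\<dots> \<le> ennreal (L powr p) * emeasure lebesgue ?B
      + (\<Sum>k. ?k * (ennreal ((2 ^ k * s) powr (p - 1)) * (\<integral>\<^sup>+x \<in> ?B2. tail f (2 ^ k * s) x \<partial>lebesgue)))"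
    by (intro add_left_mono suminf_le level) auto
  \<comment> \<open>This exchange of sum and integral plays the part of Fubini's theorem: all tails
    are integrated over the same ball B(a,2r), so the sum can be taken pointwise.\<close>
  also have "(\<Sum>k. ?k * (ennreal ((2 ^ k * s) powr (p - 1)) * (\<integral>\<^sup>+x \<in> ?B2. tail f (2 ^ k * s) x \<partial>lebesgue)))
      = ?k * (\<integral>\<^sup>+x. (\<Sum>k. ennreal ((2 ^ k * s) powr (p - 1)) * (tail f (2 ^ k * s) x * indicator ?B2 x)) \<partial>lebesgue)"
    by (simp add: nn_integral_suminf nn_integral_cmult)
  also have "\<dots> \<le> ?k * (\<integral>\<^sup>+x. ennreal g * (epow (modulus f x) p * indicator ?B2 x) \<partial>lebesgue)"
  proof (intro mult_left_mono nn_integral_mono)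
    fix x
    have "(\<Sum>k. ennreal ((2 ^ k * s) powr (p - 1)) * (tail f (2 ^ k * s) x * indicator ?B2 x))
        = (modulus f x * (\<Sum>k. ennreal ((2 ^ k * s) powr (p - 1)) * indicator {ennreal (2 ^ k * s)<..} (modulus f x)))
          * indicator ?B2 x"
      by (simp add: mult_ac flip: ennreal_suminf_cmult)
    also have "\<dots> \<le> (ennreal g * epow (modulus f x) p) * indicator ?B2 x"
      unfolding g_def using \<open>0 < s\<close> \<open>1 < p\<close> by (intro mult_right_mono dyadic_sum_le_epow) auto
    finally show "(\<Sum>k. ennreal ((2 ^ k * s) powr (p - 1)) * (tail f (2 ^ k * s) x * indicator ?B2 x))
        \<le> ennreal g * (epow (modulus f x) p * indicator ?B2 x)" by (simp add: mult.assoc)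
  qed simp
  also have "\<dots> = ?k * (ennreal g * (\<integral>\<^sup>+x \<in> ?B2. epow (modulus f x) p \<partial>lebesgue))"
    by (subst nn_integral_cmult) auto
  also have "\<dots> \<le> ?k * (ennreal g * ennreal (N powr p * \<phi> (2 * r) * measure lebesgue ?B2))"
    using assms by (intro mult_left_mono morrey_normD) auto
  also have "\<dots> \<le> ennreal (?c2 * ?X)"
  proof -
    have ten: "(10 :: real) ^ CARD('n) = 5 ^ CARD('n) * 2 ^ CARD('n)"
      by (simp flip: power_mult_distrib)
    have "measure lebesgue ?B2 = 2 ^ CARD('n) * m"
      using measure_ball_scale[of r 2 a a] \<open>0 < r\<close> by (simp add: m_def)
    then have "(4 powr p * 5 ^ CARD('n)) * (g * (N powr p * \<phi> (2 * r) * measure lebesgue ?B2))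
        = (4 powr p * 10 ^ CARD('n) * g * N powr p * m) * \<phi> (2 * r)"
      unfolding ten by simp
    also have "\<dots> \<le> (4 powr p * 10 ^ CARD('n) * g * N powr p * m) * (D * \<phi> r)"
      using assms \<open>0 < m\<close> \<open>0 < g\<close> by (intro mult_left_mono doubling) auto
    also have "\<dots> = ?c2 * ?X" by (simp add: m_def g_def)
    finally show ?thesis using \<open>0 < g\<close> by (simp add: ennreal_leI flip: ennreal_mult')
  qed
  finally have "(\<integral>\<^sup>+x \<in> ?B. epow (HL_maximal f x) p \<partial>lebesgue)
      \<le> ennreal (L powr p) * emeasure lebesgue ?B + ennreal (?c2 * ?X)"
    by (simp add: add_left_mono)
  also have "ennreal (L powr p) * emeasure lebesgue ?B = ennreal (?c1 * ?X)"
    unfolding Lp by (simp add: emeasure_ball_eq mult_ac flip: ennreal_mult')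
  also have "ennreal (?c1 * ?X) + ennreal (?c2 * ?X) = ennreal ((?c1 + ?c2) * ?X)"
  proof -
    have "0 \<le> ?c1 * ?X" "0 \<le> ?c2 * ?X"
      using assms(3-5) \<open>0 < \<phi> r\<close> \<open>0 < g\<close> unfolding g_def by (auto intro!: mult_nonneg_nonneg)
    then show ?thesis by (simp only: distrib_right ennreal_plus)
  qed
  finally show ?thesis .
qed

section \<open>From the maximal function to the fractional maximal function\<close>

lemma frac_maximal_le_HL_maximal:
  fixes f :: "real ^ 'n \<Rightarrow> ereal"
  assumes rho: "\<And>r. 0 < r \<Longrightarrow> 0 < \<rho> r" and pos: "\<And>r. 0 < r \<Longrightarrow> 0 < \<phi> r"
    and cond: "\<And>r. 0 < r \<Longrightarrow> \<rho> r * \<phi> r powr (1 / p) \<le> A * \<phi> r powr (1 / q)"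
    and avg: "\<And>a r. 0 < r \<Longrightarrow> (\<integral>\<^sup>+x \<in> ball a r. modulus f x \<partial>lebesgue)
      \<le> ennreal (K * \<phi> r powr (1 / p) * N * measure lebesgue (ball a r))"
    and pq: "0 < p" "p \<le> q" and "0 < A" "0 < K" "0 \<le> N"
  shows "frac_maximal \<rho> f x
    \<le> ennreal (A * K powr (1 - p / q)) * epow (HL_maximal f x) (p / q) * epow (ennreal N) (1 - p / q)"
    (is "_ \<le> ?R")
  unfolding frac_maximal_def
proof (rule SUP_least, clarify)
  fix a :: "real ^ 'n" and r assume r: "0 < r" "x \<in> ball a r"
  define \<theta> where "\<theta> = p / q"
  have \<theta>: "0 < \<theta>" "\<theta> \<le> 1" using pq by (auto simp: \<theta>_def)
  let ?V = "(\<integral>\<^sup>+y \<in> ball a r. modulus f y \<partial>lebesgue) / emeasure lebesgue (ball a r)"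
  have "0 < \<phi> r" "0 < \<rho> r" and m: "0 < measure lebesgue (ball a r)"
    using r pos rho measure_ball_pos by auto
  have V: "?V \<le> ennreal (K * \<phi> r powr (1 / p) * N)"
    unfolding emeasure_ball_eq div_ennreal_le_iff[OF m]
    using avg[OF r(1), of a] m by (simp add: ennreal_mult'')
  then have "?V < top" by (rule order.strict_trans1) simp
  then obtain y where y: "0 \<le> y" "?V = ennreal y" by (cases ?V) auto
  have yN: "y \<le> K * \<phi> r powr (1 / p) * N"
    using V y assms(7,8,9) by (simp add: ennreal_le_iff)
  \<comment> \<open>A vanishing average makes the left side 0. A positive one forces N > 0, which
    the real powers of N below require.\<close>
  show "ennreal (\<rho> r) * ?V \<le> ?R"
  proof (cases "y = 0")
    case False
    with y have "0 < y" by simp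
    with yN have "0 < K * \<phi> r powr (1 / p) * N" by simp
    then have "0 < N" using \<open>0 \<le> N\<close> by (cases "N = 0") auto
    have HL: "ennreal y \<le> HL_maximal f x"
      unfolding HL_maximal_def using frac_maximal_ge[of r x a "\<lambda>_. 1" f] r y by simp
    have "y = y powr \<theta> * y powr (1 - \<theta>)" using \<open>0 < y\<close> by (simp flip: powr_add)
    also have "\<dots> \<le> y powr \<theta> * (K * \<phi> r powr (1 / p) * N) powr (1 - \<theta>)"
      using \<theta> y yN by (intro mult_left_mono powr_mono2) auto
    also have "(K * \<phi> r powr (1 / p) * N) powr (1 - \<theta>)
        = K powr (1 - \<theta>) * N powr (1 - \<theta>) * \<phi> r powr (1 / p - 1 / q)"
      using \<open>0 < K\<close> \<open>0 < N\<close> pq by (simp add: powr_mult powr_powr \<theta>_def field_simps)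
    finally have "\<rho> r * y \<le> \<rho> r * (y powr \<theta> * (K powr (1 - \<theta>) * N powr (1 - \<theta>) * \<phi> r powr (1 / p - 1 / q)))"
      using \<open>0 < \<rho> r\<close> by (intro mult_left_mono) auto
    also have "\<dots> = (\<rho> r * \<phi> r powr (1 / p)) / \<phi> r powr (1 / q) * (y powr \<theta> * K powr (1 - \<theta>) * N powr (1 - \<theta>))"
      by (simp add: powr_diff[of "\<phi> r"] mult_ac)
    also have "\<dots> \<le> A * (y powr \<theta> * K powr (1 - \<theta>) * N powr (1 - \<theta>))"
      using cond[OF r(1)] \<open>0 < \<phi> r\<close> by (intro mult_right_mono) (auto simp: pos_divide_le_eq)
    finally have "ennreal (\<rho> r * y) \<le> ennreal ((A * K powr (1 - \<theta>)) * y powr \<theta> * N powr (1 - \<theta>))"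
      by (intro ennreal_leI) (simp add: mult_ac)
    also have "\<dots> = ennreal (A * K powr (1 - \<theta>)) * epow (ennreal y) \<theta> * epow (ennreal N) (1 - \<theta>)"
    proof -
      \<comment> \<open>For p = q the exponent is 0 and both sides are 1: the left by the convention
        in \<open>epow\<close>, the right because N > 0.\<close>
      have "epow (ennreal N) (1 - \<theta>) = ennreal (N powr (1 - \<theta>))"
        using \<open>0 < N\<close> by (auto simp: epow_def)
      then show ?thesis
        using \<open>0 < y\<close> \<theta> \<open>0 < A\<close> by (simp add: epow_ennreal flip: ennreal_mult'')
    qed
    also have "\<dots> \<le> ennreal (A * K powr (1 - \<theta>)) * epow (HL_maximal f x) \<theta> * epow (ennreal N) (1 - \<theta>)"
      using HL \<theta> by (intro mult_right_mono mult_left_mono epow_mono) auto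
    finally show ?thesis
      using y \<open>0 < \<rho> r\<close> by (simp add: \<theta>_def ennreal_mult)
  next
    case True
    then show ?thesis unfolding y(2) by simp
  qed
qed

lemma weak_morrey_norm_frac_maximal_le:
  fixes f :: "real ^ 'n \<Rightarrow> ereal"
  assumes pointwise: "\<And>x. frac_maximal \<rho> f x
      \<le> ennreal C * epow (HL_maximal f x) (p / q) * epow (ennreal N) (1 - p / q)"
    and level: "\<And>a r t. 0 < r \<Longrightarrow> 0 < t \<Longrightarrow> emeasure lebesgue {x \<in> ball a r. ennreal t < HL_maximal f x}
      \<le> ennreal (c * (N powr p * \<phi> r * measure lebesgue (ball a r)) / t powr p)"
    and pos: "\<And>r. 0 < r \<Longrightarrow> 0 < \<phi> r"
    and pq: "0 < p" "p \<le> q" and "0 < C" "0 < N" "0 < c"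
  shows "weak_morrey_norm q \<phi> (frac_maximal_op \<rho> f) \<le> ennreal (C * c powr (1 / q) * N)"
proof (rule weak_morrey_norm_le_iff[THEN iffD2]; (intro allI impI)?)
  fix a :: "real ^ 'n" and r t :: real assume "0 < r" "0 < t"
  define k where "k = C * N powr (1 - p / q)"
  \<comment> \<open>The solution of k u^{p/q} = t: by the pointwise bound, M_rho f can exceed t only
    where M f exceeds u.\<close>
  define u where "u = (t / k) powr (q / p)"
  have "0 < k" using assms(6,7) by (simp add: k_def)
  then have "0 < u" using \<open>0 < t\<close> by (simp add: u_def)
  have u_powr: "u powr (p / q) = t / k" "u powr p = t powr q / k powr q"
    using pq \<open>0 < k\<close> \<open>0 < t\<close> by (auto simp: u_def powr_powr powr_divide)
  have "k powr q = C powr q * N powr (q - p)"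
    using assms(4-7) by (simp add: k_def powr_mult powr_powr left_diff_distrib)
  \<comment> \<open>The power N^{q-p} from the pointwise inequality and N^p from the estimate for M
    combine to N^q, so the final norm bound is linear in N.\<close>
  then have "k powr q * N powr p = C powr q * N powr q"
    using \<open>0 < N\<close> by (simp add: powr_diff)
  also have "c * \<dots> = (C * c powr (1 / q) * N) powr q"
    using assms(4-8) by (simp add: powr_mult powr_powr)
  finally have const: "c * (k powr q * N powr p) = (C * c powr (1 / q) * N) powr q" .
  have HL: "{x \<in> ball a r. ennreal u < HL_maximal f x} \<in> sets lebesgue" by measurable
  have "ennreal u < HL_maximal f x" if "ennreal t < frac_maximal \<rho> f x" for x
  proof (rule ccontr)
    assume "\<not> ennreal u < HL_maximal f x"
    then have "epow (HL_maximal f x) (p / q) \<le> epow (ennreal u) (p / q)"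
      using pq by (intro epow_mono) auto
    also have "\<dots> = ennreal (t / k)" using \<open>0 < u\<close> pq by (simp add: epow_ennreal flip: u_powr)
    finally have "frac_maximal \<rho> f x \<le> ennreal C * ennreal (t / k) * epow (ennreal N) (1 - p / q)"
      using pointwise[of x] by (meson mult_left_mono mult_right_mono order_trans zero_le)
    also have "epow (ennreal N) (1 - p / q) = ennreal (N powr (1 - p / q))"
      using \<open>0 < N\<close> by (auto simp: epow_def)
    also have "ennreal C * ennreal (t / k) * ennreal (N powr (1 - p / q))
        = ennreal (C * (t / k) * N powr (1 - p / q))"
      using \<open>0 < C\<close> \<open>0 < t\<close> \<open>0 < k\<close>
      by (simp add: ennreal_mult'' del: times_divide_eq_right)
    also have "C * (t / k) * N powr (1 - p / q) = t"
      using \<open>0 < C\<close> \<open>0 < N\<close> by (simp add: k_def)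
    finally show False using that by simp
  qed
  then have "emeasure lebesgue {x \<in> ball a r. ennreal t < frac_maximal \<rho> f x}
      \<le> emeasure lebesgue {x \<in> ball a r. ennreal u < HL_maximal f x}"
    using HL by (intro emeasure_mono) auto
  also have "\<dots> \<le> ennreal (c * (N powr p * \<phi> r * measure lebesgue (ball a r)) / u powr p)"
    using \<open>0 < r\<close> \<open>0 < u\<close> by (rule level)
  also have "c * (N powr p * \<phi> r * measure lebesgue (ball a r)) / u powr p
      = (C * c powr (1 / q) * N) powr q * \<phi> r * measure lebesgue (ball a r) / t powr q"
    unfolding u_powr const[symmetric] by simp
  finally show "emeasure lebesgue {x \<in> ball a r. ennreal t < modulus (frac_maximal_op \<rho> f) x}
      \<le> ennreal ((C * c powr (1 / q) * N) powr q * \<phi> r * measure lebesgue (ball a r) / t powr q)"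
    by simp
qed (use assms(4-8) pos in auto)

text \<open>Raising the pointwise inequality to the power q turns the exponent p / q of M f into p,
  so the L^p estimate for M on each ball gives an L^q estimate for M_rho with the same
  weight.\<close>

lemma morrey_norm_frac_maximal_le:
  fixes f :: "real ^ 'n \<Rightarrow> ereal"
  assumes pointwise: "\<And>x. frac_maximal \<rho> f x
      \<le> ennreal C * epow (HL_maximal f x) (p / q) * epow (ennreal N) (1 - p / q)"
    and strong: "\<And>a r. 0 < r \<Longrightarrow> (\<integral>\<^sup>+x \<in> ball a r. epow (HL_maximal f x) p \<partial>lebesgue)
      \<le> ennreal (c * (N powr p * \<phi> r * measure lebesgue (ball a r)))"
    and pos: "\<And>r. 0 < r \<Longrightarrow> 0 < \<phi> r"
    and pq: "0 < p" "p \<le> q" and "0 < C" "0 < N" "0 < c"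
  shows "morrey_norm q \<phi> (frac_maximal_op \<rho> f) \<le> ennreal (C * c powr (1 / q) * N)"
proof (rule morrey_norm_le_iff[THEN iffD2]; (intro allI impI)?)
  fix a :: "real ^ 'n" and r :: real assume "0 < r"
  define k where "k = C * N powr (1 - p / q)"
  have "0 < k" using assms(6,7) by (simp add: k_def)
  have "k powr q = C powr q * N powr (q - p)"
    using assms(4-7) by (simp add: k_def powr_mult powr_powr left_diff_distrib)
  then have "k powr q * N powr p = C powr q * N powr q"
    using \<open>0 < N\<close> by (simp add: powr_diff)
  also have "c * \<dots> = (C * c powr (1 / q) * N) powr q"
    using assms(4-8) by (simp add: powr_mult powr_powr)
  finally have const: "c * (k powr q * N powr p) = (C * c powr (1 / q) * N) powr q" .
  have le: "epow (frac_maximal \<rho> f x) q \<le> ennreal (k powr q) * epow (HL_maximal f x) p" for x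
  proof -
    have "epow (ennreal N) (1 - p / q) = ennreal (N powr (1 - p / q))"
      using \<open>0 < N\<close> by (auto simp: epow_def)
    then have "frac_maximal \<rho> f x \<le> ennreal k * epow (HL_maximal f x) (p / q)"
      using pointwise[of x] \<open>0 < C\<close> by (simp add: k_def ennreal_mult' mult_ac)
    then have "epow (frac_maximal \<rho> f x) q \<le> epow (ennreal k * epow (HL_maximal f x) (p / q)) q"
      using pq by (intro epow_mono) auto
    also have "\<dots> = ennreal (k powr q) * epow (HL_maximal f x) p"
      using pq \<open>0 < k\<close> by (simp add: epow_cmult epow_powr)
    finally show ?thesis .
  qed
  have "(\<integral>\<^sup>+x \<in> ball a r. epow (frac_maximal \<rho> f x) q \<partial>lebesgue)
      \<le> (\<integral>\<^sup>+x. ennreal (k powr q) * (epow (HL_maximal f x) p * indicator (ball a r) x) \<partial>lebesgue)"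
    unfolding mult.assoc[symmetric] by (intro nn_integral_mono mult_right_mono le) auto
  also have "\<dots> = ennreal (k powr q) * (\<integral>\<^sup>+x \<in> ball a r. epow (HL_maximal f x) p \<partial>lebesgue)"
    by (rule nn_integral_cmult) measurable
  also have "\<dots> \<le> ennreal (k powr q) * ennreal (c * (N powr p * \<phi> r * measure lebesgue (ball a r)))"
    using \<open>0 < r\<close> by (intro mult_left_mono strong) auto
  also have "\<dots> = ennreal ((C * c powr (1 / q) * N) powr q * \<phi> r * measure lebesgue (ball a r))"
    unfolding const[symmetric] by (simp add: mult_ac flip: ennreal_mult')
  finally show "(\<integral>\<^sup>+x \<in> ball a r. epow (modulus (frac_maximal_op \<rho> f) x) q \<partial>lebesgue)
      \<le> ennreal ((C * c powr (1 / q) * N) powr q * \<phi> r * measure lebesgue (ball a r))"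
    by simp
qed (use assms(4-8) pos in auto)

text \<open>Reduces boundedness to real bounds N > 0 of the source norm. Letting N decrease to the
  norm recovers the exact inequality, also for functions of norm 0; finiteness of the target norm
  then yields membership.\<close>

lemma bounded_operatorI:
  assumes "0 < C" and finite: "\<And>f. f \<in> X \<Longrightarrow> norm_X f < \<infinity>"
    and mem: "\<And>f. f \<in> X \<Longrightarrow> norm_Y (T f) < \<infinity> \<Longrightarrow> T f \<in> Y"
    and le: "\<And>f N. f \<in> X \<Longrightarrow> 0 < N \<Longrightarrow> norm_X f \<le> ennreal N \<Longrightarrow> norm_Y (T f) \<le> ennreal (C * N)"
  shows "bounded_operator T X norm_X Y norm_Y"
  unfolding bounded_operator_def
proof (intro exI conjI ballI)
  fix f assume f: "f \<in> X"
  from finite[OF this] obtain M where M: "0 \<le> M" "norm_X f = ennreal M" by (cases "norm_X f") auto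
  have "norm_Y (T f) \<le> ennreal (C * M)"
  proof (rule ennreal_le_cmult_of_gt[OF \<open>0 < C\<close>])
    fix N assume "M < N"
    with M f show "norm_Y (T f) \<le> ennreal (C * N)" by (intro le) (auto simp: ennreal_leI)
  qed
  then show "norm_Y (T f) \<le> ennreal C * norm_X f"
    using M \<open>0 < C\<close> by (simp add: ennreal_mult)
  with M have "norm_Y (T f) < \<infinity>"
    by (metis ennreal_less_top ennreal_mult_less_top infinity_ennreal_def order.strict_trans1)
  then show "T f \<in> Y" by (rule mem[OF f])
qed fact

section \<open>Necessity\<close>

lemma modulus_indicator [simp]: "modulus (indicator B) = indicator B"
proof
  fix x
  have "\<bar>indicator B x :: ereal\<bar> = enn2ereal (indicator B x)" 
    by (simp add: indicator_def zero_ennreal.rep_eq one_ennreal.rep_eq)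
  then show "modulus (indicator B) x = indicator B x" by (simp add: modulus_def e2ennreal_enn2ereal)
qed

text \<open>Each half of the \<open>G_dec\<close> condition handles one range of test balls. For s
  \<le> r the intersection is bounded by B(a,s) and almost monotonicity of \<phi> applies; for s > r
  it is bounded by B(0,r), and the almost increasing \<phi>(r) r^n compensates for the ratio of the
  volumes.\<close>

lemma morrey_norm_indicator_ball_le:
  assumes "1 \<le> p" and pos: "\<And>r. 0 < r \<Longrightarrow> 0 < \<phi> r" and "1 \<le> C"
    and dec: "\<And>r s. 0 < r \<Longrightarrow> r \<le> s \<Longrightarrow> \<phi> s \<le> C * \<phi> r"
    and incr: "\<And>r s. 0 < r \<Longrightarrow> r \<le> s \<Longrightarrow> \<phi> r * r ^ CARD('n) \<le> C * (\<phi> s * s ^ CARD('n))"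
    and "0 < r"
  shows "morrey_norm p \<phi> (indicator (ball 0 r) :: real ^ 'n \<Rightarrow> ereal) \<le> ennreal ((C / \<phi> r) powr (1 / p))"
proof (rule morrey_norm_le_iff[THEN iffD2]; (intro allI impI)?)
  fix a :: "real ^ 'n" and s :: real assume "0 < s"
  let ?m = "\<lambda>(a :: real ^ 'n) r. measure lebesgue (ball a r)"
  have "0 < \<phi> r" "0 < \<phi> s" using pos \<open>0 < r\<close> \<open>0 < s\<close> by auto
  have "(\<integral>\<^sup>+x \<in> ball a s. epow (modulus (indicator (ball 0 r)) x) p \<partial>lebesgue)
      = (\<integral>\<^sup>+x. indicator (ball a s \<inter> ball 0 r) x \<partial>lebesgue)"
    using \<open>1 \<le> p\<close> by (intro nn_integral_cong) (auto simp: indicator_def epow_def)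
  also have "\<dots> = emeasure lebesgue (ball a s \<inter> ball (0 :: real ^ 'n) r)"
    by (rule nn_integral_indicator) auto
  also have "\<dots> \<le> ennreal (C / \<phi> r * \<phi> s * ?m a s)"
  proof (cases "s \<le> r")
    case True
    then have "1 \<le> C / \<phi> r * \<phi> s"
      using dec[of s r] \<open>0 < s\<close> \<open>0 < \<phi> r\<close> by (simp add: pos_le_divide_eq)
    then have "?m a s \<le> C / \<phi> r * \<phi> s * ?m a s"
      using mult_right_mono[of 1 "C / \<phi> r * \<phi> s" "?m a s"] by simp
    moreover have "emeasure lebesgue (ball a s \<inter> ball 0 r) \<le> emeasure lebesgue (ball a s)"
      by (intro emeasure_mono) auto
    ultimately show ?thesis
      unfolding emeasure_ball_eq by (meson ennreal_leI order_trans)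
  next
    case False
    have scale: "?m 0 r = r ^ CARD('n) * ?m 0 1" "?m a s = s ^ CARD('n) * ?m 0 1"
      using measure_ball_scale[of 1 r 0 0] measure_ball_scale[of 1 s a 0] \<open>0 < r\<close> \<open>0 < s\<close> by auto
    have "r ^ CARD('n) \<le> C / \<phi> r * \<phi> s * s ^ CARD('n)"
      using incr[of r s] False \<open>0 < r\<close> \<open>0 < \<phi> r\<close> by (simp add: pos_le_divide_eq mult_ac)
    then have "r ^ CARD('n) * ?m 0 1 \<le> C / \<phi> r * \<phi> s * s ^ CARD('n) * ?m 0 1"
      by (rule mult_right_mono) simp
    then have "?m 0 r \<le> C / \<phi> r * \<phi> s * ?m a s"
      unfolding scale by (simp only: mult.assoc)
    moreover have "emeasure lebesgue (ball a s \<inter> ball 0 r) \<le> emeasure lebesgue (ball (0 :: real ^ 'n) r)"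
      by (intro emeasure_mono) auto
    ultimately show ?thesis
      unfolding emeasure_ball_eq by (meson ennreal_leI order_trans)
  qed
  also have "C / \<phi> r = ((C / \<phi> r) powr (1 / p)) powr p"
    using \<open>1 \<le> p\<close> \<open>1 \<le> C\<close> \<open>0 < \<phi> r\<close> by (simp add: powr_powr)
  finally show "(\<integral>\<^sup>+x \<in> ball a s. epow (modulus (indicator (ball 0 r)) x) p \<partial>lebesgue)
      \<le> ennreal (((C / \<phi> r) powr (1 / p)) powr p * \<phi> s * ?m a s)" .
qed (use assms(1) pos in auto)

lemma frac_maximal_indicator_ge:
  fixes x :: "real ^ 'n"
  assumes "0 < t" "t \<le> r" "x \<in> ball 0 r"
  shows "ennreal (\<rho> t) \<le> frac_maximal \<rho> (indicator (ball 0 r)) x"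
proof -
  \<comment> \<open>Pulling x towards the origin by the factor 1 - t/r keeps the centre within r - t
    of 0, so the ball of radius t fits into B(0,r), and moves it from x by t|x|/r < t, so x stays
    inside. For t = r the centre is 0.\<close>
  define b where "b = (1 - t / r) *\<^sub>R x"
  have "0 < r" "norm x < r" using assms by auto
  have "x - b = (t / r) *\<^sub>R x" by (simp add: b_def algebra_simps)
  then have "dist b x = t * (norm x / r)" using \<open>0 < t\<close> \<open>0 < r\<close> by (simp add: dist_norm norm_minus_commute[of b])
  also have "\<dots> < t * 1" using assms \<open>0 < r\<close> \<open>norm x < r\<close> by (intro mult_strict_left_mono) auto
  finally have "x \<in> ball b t" by simp
  have "norm b = (1 - t / r) * norm x" using assms \<open>0 < r\<close> by (simp add: b_def)
  also have "\<dots> \<le> (1 - t / r) * r" using assms \<open>0 < r\<close> \<open>norm x < r\<close> by (intro mult_left_mono) auto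
  also have "\<dots> = r - t" using \<open>0 < r\<close> by (simp add: left_diff_distrib)
  finally have "ball b t \<subseteq> ball 0 r"
    by (auto simp: subset_iff dist_norm) (smt (verit) norm_minus_commute norm_triangle_ineq2)
  then have "(\<integral>\<^sup>+y \<in> ball b t. modulus (indicator (ball 0 r)) y \<partial>lebesgue)
      = (\<integral>\<^sup>+y. indicator (ball b t) y \<partial>lebesgue)"
    by (intro nn_integral_cong) (auto simp: indicator_def)
  also have "\<dots> = emeasure lebesgue (ball b t)" by (rule nn_integral_indicator) auto
  finally have "(\<integral>\<^sup>+y \<in> ball b t. modulus (indicator (ball 0 r)) y \<partial>lebesgue) / emeasure lebesgue (ball b t) = 1"
    using measure_ball_pos[OF \<open>0 < t\<close>, of b] unfolding emeasure_ball_eq by (simp add: divide_ennreal)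
  then show ?thesis
    using frac_maximal_ge[OF \<open>0 < t\<close> \<open>x \<in> ball b t\<close>, of \<rho> "indicator (ball 0 r)"] by simp
qed

lemma sup_conditionI:
  assumes "\<And>r t. 0 < t \<Longrightarrow> t \<le> r \<Longrightarrow> \<rho> t * \<phi> r powr (1 / p) \<le> A * \<phi> r powr (1 / q)"
  shows "sup_condition p q \<phi> \<rho> A"
  unfolding sup_condition_def
  by (auto simp: SUP_mult_right_ennreal intro!: SUP_least ennreal_leI assms simp flip: ennreal_mult'')

lemma sup_conditionD:
  assumes "sup_condition p q \<phi> \<rho> A" "0 \<le> A" "0 < r" "0 \<le> \<rho> r"
  shows "\<rho> r * \<phi> r powr (1 / p) \<le> A * \<phi> r powr (1 / q)"
proof -
  have "ennreal (\<rho> r) * ennreal (\<phi> r powr (1 / p)) \<le> (SUP t\<in>{0<..r}. ennreal (\<rho> t)) * ennreal (\<phi> r powr (1 / p))"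
    using \<open>0 < r\<close> by (intro mult_right_mono SUP_upper) auto
  also have "\<dots> \<le> ennreal (A * \<phi> r powr (1 / q))"
    using assms by (auto simp: sup_condition_def)
  finally show ?thesis
    using assms by (simp add: ennreal_le_iff flip: ennreal_mult')
qed

text \<open>The common core of both necessity statements: the target space enters only through a
  lower bound for the norm of M_rho applied to the indicator of a ball, stated in
  \<open>lower\<close>.\<close>

lemma sup_condition_of_bounded:
  fixes Y :: "(real ^ 'n \<Rightarrow> ereal) set"
  assumes "1 \<le> p" and phi: "\<phi> \<in> G_dec CARD('n)" and rho: "\<And>r. 0 < r \<Longrightarrow> 0 < \<rho> r"
    and bounded: "bounded_operator (frac_maximal_op \<rho>) (morrey p \<phi>) (morrey_norm p \<phi>) Y norm_Y"
    and lower: "\<And>r t N. 0 < t \<Longrightarrow> t \<le> r \<Longrightarrow> 0 < N \<Longrightarrow>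
      norm_Y (frac_maximal_op \<rho> (indicator (ball 0 r))) \<le> ennreal N \<Longrightarrow> \<rho> t \<le> 2 * N * \<phi> r powr (1 / q)"
  shows "\<exists>A>0. sup_condition p q \<phi> \<rho> A"
proof -
  have pos: "\<And>r. 0 < r \<Longrightarrow> 0 < \<phi> r" using phi by (simp add: G_dec_def)
  obtain C where C: "1 \<le> C" "\<And>r s. 0 < r \<Longrightarrow> r \<le> s \<Longrightarrow> \<phi> s \<le> C * \<phi> r"
    "\<And>r s. 0 < r \<Longrightarrow> r \<le> s \<Longrightarrow> \<phi> r * r ^ CARD('n) \<le> C * (\<phi> s * s ^ CARD('n))"
    using G_decE[OF phi] by metis
  obtain C' where "0 < C'" and C': "\<And>f. f \<in> morrey p \<phi> \<Longrightarrow>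
      norm_Y (frac_maximal_op \<rho> f) \<le> ennreal C' * morrey_norm p \<phi> f"
    using bounded unfolding bounded_operator_def by blast
  show ?thesis
  proof (intro exI conjI sup_conditionI)
    \<comment> \<open>The factors come from \<open>lower\<close>, from the operator bound, and from
      the norm of the indicator, respectively.\<close>
    show "0 < 2 * C' * C powr (1 / p)" using \<open>0 < C'\<close> C(1) by simp
    fix r t :: real assume t: "0 < t" "t \<le> r"
    then have "0 < r" "0 < \<phi> r" using pos by auto
    let ?\<chi> = "indicator (ball 0 r) :: real ^ 'n \<Rightarrow> ereal"
    let ?N = "(C / \<phi> r) powr (1 / p)"
    have "0 < ?N" using C(1) \<open>0 < \<phi> r\<close> by simp
    have \<chi>: "morrey_norm p \<phi> ?\<chi> \<le> ennreal ?N"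
      by (rule morrey_norm_indicator_ball_le[OF \<open>1 \<le> p\<close> pos C \<open>0 < r\<close>])
    then have "morrey_norm p \<phi> ?\<chi> < \<infinity>"
      by (metis ennreal_less_top infinity_ennreal_def order.strict_trans1)
    then have "?\<chi> \<in> morrey p \<phi>"
      unfolding morrey_def by (auto intro!: borel_measurable_indicator)
    from C'[OF this] have "norm_Y (frac_maximal_op \<rho> ?\<chi>) \<le> ennreal C' * ennreal ?N"
      using \<chi> by (meson mult_left_mono order_trans zero_le)
    then have "\<rho> t \<le> 2 * (C' * ?N) * \<phi> r powr (1 / q)"
      using t \<open>0 < ?N\<close> \<open>0 < C'\<close> by (intro lower) (auto simp: ennreal_mult)
    then have "\<rho> t * \<phi> r powr (1 / p) \<le> 2 * (C' * ?N) * \<phi> r powr (1 / q) * \<phi> r powr (1 / p)"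
      by (rule mult_right_mono) simp
    also have "\<dots> = 2 * C' * C powr (1 / p) * \<phi> r powr (1 / q)"
      using C(1) \<open>0 < \<phi> r\<close> by (simp add: powr_divide)
    finally show "\<rho> t * \<phi> r powr (1 / p) \<le> 2 * C' * C powr (1 / p) * \<phi> r powr (1 / q)" .
  qed
qed

lemma rho_le_of_weak_morrey_norm:
  assumes "0 < q" and pos: "\<And>r. 0 < r \<Longrightarrow> 0 < \<phi> r" and rho: "\<And>r. 0 < r \<Longrightarrow> 0 < \<rho> r"
    and "0 < t" "t \<le> r" "0 < N"
    and norm: "weak_morrey_norm q \<phi> (frac_maximal_op \<rho> (indicator (ball (0 :: real ^ 'n) r))) \<le> ennreal N"
  shows "\<rho> t \<le> 2 * N * \<phi> r powr (1 / q)"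
proof -
  let ?B = "ball (0 :: real ^ 'n) r"
  \<comment> \<open>The weak norm uses strict superlevel sets, so a level strictly below \<rho>(t)
    is needed for the whole ball to lie in one; half of it costs the factor 2 in the
    conclusion.\<close>
  define s where "s = \<rho> t / 2"
  have "0 < r" "0 < s" "0 < \<phi> r" using assms(4,5) rho pos by (auto simp: s_def)
  have m: "0 < measure lebesgue ?B" using \<open>0 < r\<close> by (rule measure_ball_pos)
  have "s < \<rho> t" using \<open>0 < s\<close> by (simp add: s_def)
  then have "ennreal s < ennreal (\<rho> t)" using \<open>0 < s\<close> by (simp add: ennreal_less_iff)
  then have "ennreal s < frac_maximal \<rho> (indicator ?B) x" if "x \<in> ?B" for x
    using frac_maximal_indicator_ge[OF assms(4,5) that] by (rule order.strict_trans2)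
  then have "?B = {x \<in> ?B. ennreal s < modulus (frac_maximal_op \<rho> (indicator ?B)) x}" by auto
  then have "emeasure lebesgue ?B = emeasure lebesgue {x \<in> ?B. ennreal s < modulus (frac_maximal_op \<rho> (indicator ?B)) x}"
    by (rule arg_cong)
  also have "\<dots> \<le> ennreal (N powr q * \<phi> r * measure lebesgue ?B / s powr q)"
    using assms(1,6) \<open>0 < s\<close> \<open>0 < r\<close> by (intro weak_morrey_normD[OF _ _ pos norm]) auto
  finally have "measure lebesgue ?B \<le> N powr q * \<phi> r * measure lebesgue ?B / s powr q"
    unfolding emeasure_ball_eq using \<open>0 < \<phi> r\<close> by (subst (asm) ennreal_le_iff) auto
  then have "s powr q * measure lebesgue ?B \<le> N powr q * \<phi> r * measure lebesgue ?B"
    using \<open>0 < s\<close> by (simp add: pos_le_divide_eq mult_ac)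
  then have "s powr q \<le> N powr q * \<phi> r" using m by simp
  also have "\<dots> = (N * \<phi> r powr (1 / q)) powr q"
    using assms(1,6) \<open>0 < \<phi> r\<close> by (simp add: powr_mult powr_powr)
  finally have "s \<le> N * \<phi> r powr (1 / q)"
    using assms(1,6) \<open>0 < s\<close> powr_less_mono2[of q "N * \<phi> r powr (1 / q)" s]
    by (meson leD leI mult_nonneg_nonneg less_imp_le powr_ge_zero)
  then show ?thesis by (simp add: s_def)
qed

text \<open>Integrating the lower bound \<rho>(t) over B(0,r) itself gives the claim. The weight is
  later taken to be \<phi>^{1/q}.\<close>

lemma rho_le_of_morrey_norm_1:
  assumes pos: "\<And>r. 0 < r \<Longrightarrow> 0 < \<phi> r" and rho: "\<And>r. 0 < r \<Longrightarrow> 0 < \<rho> r"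
    and "0 < t" "t \<le> r" "0 < N"
    and norm: "morrey_norm 1 \<phi> (frac_maximal_op \<rho> (indicator (ball (0 :: real ^ 'n) r))) \<le> ennreal N"
  shows "\<rho> t \<le> N * \<phi> r"
proof -
  let ?B = "ball (0 :: real ^ 'n) r"
  have "0 < r" "0 < \<phi> r" "0 < \<rho> t" using assms(3,4) rho pos by auto
  have m: "0 < measure lebesgue ?B" using \<open>0 < r\<close> by (rule measure_ball_pos)
  have "ennreal (\<rho> t) * emeasure lebesgue ?B = (\<integral>\<^sup>+x. ennreal (\<rho> t) * indicator ?B x \<partial>lebesgue)"
    by (rule nn_integral_cmult_indicator[symmetric]) auto
  also have "\<dots> \<le> (\<integral>\<^sup>+x \<in> ?B. epow (modulus (frac_maximal_op \<rho> (indicator ?B)) x) 1 \<partial>lebesgue)"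
    using frac_maximal_indicator_ge[OF assms(3,4), of _ \<rho>]
    by (intro nn_integral_mono) (auto simp: indicator_def)
  also have "\<dots> \<le> ennreal (N powr 1 * \<phi> r * measure lebesgue ?B)"
    using assms(5) \<open>0 < r\<close> by (intro morrey_normD[OF _ _ pos norm]) auto
  finally have "\<rho> t * measure lebesgue ?B \<le> N * \<phi> r * measure lebesgue ?B"
    using \<open>0 < \<rho> t\<close> \<open>0 < \<phi> r\<close> \<open>0 < N\<close> unfolding emeasure_ball_eq ennreal_mult'[OF less_imp_le[OF \<open>0 < \<rho> t\<close>], symmetric]
    by (subst (asm) ennreal_le_iff) auto
  then show ?thesis using m by simp
qed

section \<open>Pointwise inequality and boundedness from tail bounds\<close>

lemma frac_maximal_le_of_tail_bound:
  fixes f :: "real ^ 'n \<Rightarrow> ereal"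
  assumes meas: "f \<in> borel_measurable lebesgue"
    and tail: "\<And>N. M < N \<Longrightarrow> tail_bound p \<phi> \<kappa> N f"
    and rho: "\<And>r. 0 < r \<Longrightarrow> 0 < \<rho> r" and pos: "\<And>r. 0 < r \<Longrightarrow> 0 < \<phi> r"
    and cond: "sup_condition p q \<phi> \<rho> A"
    and pq: "0 < p" "p \<le> q" and "0 < A" "0 \<le> \<kappa>" "0 \<le> M"
  shows "frac_maximal \<rho> f x \<le> ennreal (A * (1 + \<kappa>) powr (1 - p / q))
    * epow (HL_maximal f x) (p / q) * epow (ennreal M) (1 - p / q)"
proof (rule frac_maximal_le_HL_maximal[OF rho pos])
  show "\<rho> r * \<phi> r powr (1 / p) \<le> A * \<phi> r powr (1 / q)" if "0 < r" for r
    using sup_conditionD[OF cond _ that] rho[OF that] \<open>0 < A\<close> by simp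
  fix a :: "real ^ 'n" and r :: real assume r: "0 < r"
  let ?K = "(1 + \<kappa>) * \<phi> r powr (1 / p) * measure lebesgue (ball a r)"
  have "(\<integral>\<^sup>+x \<in> ball a r. modulus f x \<partial>lebesgue) \<le> ennreal (?K * M)"
  proof (rule ennreal_le_cmult_of_gt)
    show "0 < ?K"
      using measure_ball_pos[OF r, of a] pos[OF r] \<open>0 \<le> \<kappa>\<close> by (intro mult_pos_pos) auto
    fix N assume "M < N"
    then show "(\<integral>\<^sup>+x \<in> ball a r. modulus f x \<partial>lebesgue) \<le> ennreal (?K * N)"
      using tail_bound_integral_le[OF meas tail[OF \<open>M < N\<close>] pq(1) _ \<open>0 \<le> \<kappa>\<close> pos[OF r] r, of a] \<open>0 \<le> M\<close>
      by (simp add: mult_ac)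
  qed
  then show "(\<integral>\<^sup>+x \<in> ball a r. modulus f x \<partial>lebesgue)
      \<le> ennreal ((1 + \<kappa>) * \<phi> r powr (1 / p) * M * measure lebesgue (ball a r))"
    by (simp add: mult_ac)
qed (use assms(6-10) in auto)

lemma bounded_operator_weak_morreyI:
  fixes X :: "(real ^ 'n \<Rightarrow> ereal) set"
  assumes X: "\<And>f. f \<in> X \<Longrightarrow> f \<in> borel_measurable lebesgue" "\<And>f. f \<in> X \<Longrightarrow> norm_X f < \<infinity>"
    and tail: "\<And>f N. f \<in> X \<Longrightarrow> 0 < N \<Longrightarrow> norm_X f \<le> ennreal N \<Longrightarrow> tail_bound p \<phi> \<kappa> N f"
    and phi: "\<phi> \<in> G_dec CARD('n)" and rho: "\<And>r. 0 < r \<Longrightarrow> 0 < \<rho> r"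
    and cond: "sup_condition p q \<phi> \<rho> A"
    and pq: "1 \<le> p" "p \<le> q" and "0 < A" "0 \<le> \<kappa>"
  shows "bounded_operator (frac_maximal_op \<rho>) X norm_X (weak_morrey q \<phi>) (weak_morrey_norm q \<phi>)"
proof -
  have pos: "\<And>r. 0 < r \<Longrightarrow> 0 < \<phi> r" using phi by (simp add: G_dec_def)
  obtain D where D: "1 \<le> D" "\<And>r s. 0 < r \<Longrightarrow> r / 2 < s \<Longrightarrow> \<phi> s \<le> D * \<phi> r"
    using G_dec_doubling[OF phi] by metis
  define c where "c = (1 + \<kappa>) powr p * D + 2 powr p * 10 ^ CARD('n) * \<kappa> * D"
  define C where "C = A * (1 + \<kappa>) powr (1 - p / q)"
  have "0 < (1 + \<kappa>) powr p * D" "0 \<le> 2 powr p * 10 ^ CARD('n) * \<kappa> * D"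
    using D(1) \<open>0 \<le> \<kappa>\<close> by auto
  then have "0 < c" unfolding c_def by linarith
  have "0 < C" using \<open>0 < A\<close> \<open>0 \<le> \<kappa>\<close> by (simp add: C_def)
  show ?thesis
  proof (rule bounded_operatorI)
    show "0 < C * c powr (1 / q)" using \<open>0 < c\<close> \<open>0 < C\<close> by simp
    show "norm_X f < \<infinity>" if "f \<in> X" for f using X that by simp
    show "frac_maximal_op \<rho> f \<in> weak_morrey q \<phi>" if "weak_morrey_norm q \<phi> (frac_maximal_op \<rho> f) < \<infinity>" for f
      using that frac_maximal_op_measurable unfolding weak_morrey_def by blast
    fix f N assume f: "f \<in> X" "0 < N" "norm_X f \<le> ennreal N"
    have tail': "tail_bound p \<phi> \<kappa> N' f" if "N \<le> N'" for N'
      using f that by (intro tail) (auto intro: order_trans ennreal_leI)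
    show "weak_morrey_norm q \<phi> (frac_maximal_op \<rho> f) \<le> ennreal (C * c powr (1 / q) * N)"
    proof (rule weak_morrey_norm_frac_maximal_le)
      show "frac_maximal \<rho> f x \<le> ennreal C * epow (HL_maximal f x) (p / q) * epow (ennreal N) (1 - p / q)" for x
        unfolding C_def by (rule frac_maximal_le_of_tail_bound[OF X(1)[OF f(1)] tail' rho pos cond])
          (use assms(7-10) f in auto)
      show "emeasure lebesgue {x \<in> ball a r. ennreal t < HL_maximal f x}
          \<le> ennreal (c * (N powr p * \<phi> r * measure lebesgue (ball a r)) / t powr p)"
        if "0 < r" "0 < t" for a r t
        unfolding c_def using pq(1) f(2) \<open>0 \<le> \<kappa>\<close> D pos that
        by (intro HL_maximal_level_le[OF X(1)[OF f(1)] tail']) auto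
    qed (use pos assms(7,8) f(2) \<open>0 < c\<close> \<open>0 < C\<close> in auto)
  qed
qed

lemma bounded_operator_morreyI:
  assumes phi: "\<phi> \<in> G_dec CARD('n)" and rho: "\<And>r. 0 < r \<Longrightarrow> 0 < \<rho> r"
    and cond: "sup_condition p q \<phi> \<rho> A" and pq: "1 < p" "p \<le> q" and "0 < A"
  shows "bounded_operator (frac_maximal_op \<rho>) (morrey p \<phi> :: (real ^ 'n \<Rightarrow> ereal) set) (morrey_norm p \<phi>)
    (morrey q \<phi>) (morrey_norm q \<phi>)"
proof -
  have pos: "\<And>r. 0 < r \<Longrightarrow> 0 < \<phi> r" using phi by (simp add: G_dec_def)
  obtain D where D: "1 \<le> D" "\<And>r s. 0 < r \<Longrightarrow> r / 2 < s \<Longrightarrow> \<phi> s \<le> D * \<phi> r"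
    using G_dec_doubling[OF phi] by metis
  define c where "c = 2 powr p * D + 4 powr p * 10 ^ CARD('n) * (1 / (1 - 2 powr (1 - p))) * D"
  define C where "C = A * (1 + 1) powr (1 - p / q)"
  have "0 < 2 powr p * D" "0 \<le> 4 powr p * 10 ^ CARD('n) * (1 / (1 - 2 powr (1 - p))) * D"
    using D(1) geometric_tail[OF pq(1)] by auto
  then have "0 < c" unfolding c_def by linarith
  have "0 < C" using \<open>0 < A\<close> by (simp add: C_def)
  show ?thesis
  proof (rule bounded_operatorI)
    show "0 < C * c powr (1 / q)" using \<open>0 < c\<close> \<open>0 < C\<close> by simp
    show "morrey_norm p \<phi> f < \<infinity>" if "f \<in> morrey p \<phi>" for f :: "real ^ 'n \<Rightarrow> ereal"
      using that unfolding morrey_def by blast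
    show "frac_maximal_op \<rho> f \<in> morrey q \<phi>" if "morrey_norm q \<phi> (frac_maximal_op \<rho> f) < \<infinity>" for f :: "real ^ 'n \<Rightarrow> ereal"
      using that frac_maximal_op_measurable unfolding morrey_def by blast
    fix f :: "real ^ 'n \<Rightarrow> ereal" and N assume f: "f \<in> morrey p \<phi>" "0 < N" "morrey_norm p \<phi> f \<le> ennreal N"
    then have meas: "f \<in> borel_measurable lebesgue" unfolding morrey_def by blast
    have tail: "tail_bound p \<phi> 1 N' f" if "N < N'" for N'
    proof (rule tail_bound_strong[OF meas _ _ pos])
      show "morrey_norm p \<phi> f \<le> ennreal N'"
        using f(3) that by (meson ennreal_leI less_imp_le order_trans)
    qed (use pq f that in auto)
    show "morrey_norm q \<phi> (frac_maximal_op \<rho> f) \<le> ennreal (C * c powr (1 / q) * N)"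
    proof (rule morrey_norm_frac_maximal_le)
      show "frac_maximal \<rho> f x \<le> ennreal C * epow (HL_maximal f x) (p / q) * epow (ennreal N) (1 - p / q)" for x
        unfolding C_def by (rule frac_maximal_le_of_tail_bound[OF meas tail rho pos cond])
          (use pq \<open>0 < A\<close> f in auto)
      show "(\<integral>\<^sup>+x \<in> ball a r. epow (HL_maximal f x) p \<partial>lebesgue)
          \<le> ennreal (c * (N powr p * \<phi> r * measure lebesgue (ball a r)))" if "0 < r" for a r
        unfolding c_def by (rule HL_maximal_strong_type[OF meas f(3) pq(1) f(2) D(1) pos D(2) that])
    qed (use pos pq f(2) \<open>0 < c\<close> \<open>0 < C\<close> in auto)
  qed
qed

theorem corollary3p12:
  fixes p q :: real and \<phi> \<rho> :: "real \<Rightarrow> real"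
    and Lp Lq L1 wLp wLq :: "(real ^ 'n \<Rightarrow> ereal) set"
    and M\<^sub>\<rho> :: "(real ^ 'n \<Rightarrow> ereal) \<Rightarrow> real ^ 'n \<Rightarrow> ereal"
  assumes pq: "1 \<le> p" "p \<le> q"
    and phi: "\<phi> \<in> G_dec CARD('n)"
    and rho: "\<And>r. r > 0 \<Longrightarrow> \<rho> r > 0"
  defines "Lp \<equiv> morrey p \<phi>" and "Lq \<equiv> morrey q \<phi>"
    and "L1 \<equiv> morrey 1 (\<lambda>r. \<phi> r powr (1 / q))"
    and "wLp \<equiv> weak_morrey p \<phi>" and "wLq \<equiv> weak_morrey q \<phi>"
    and "M\<^sub>\<rho> \<equiv> frac_maximal_op \<rho>"
  shows
    "((\<exists>A>0. sup_condition p q \<phi> \<rho> A) \<longrightarrow>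
        (\<exists>C::real. C > 0 \<and>
           (\<forall>f\<in>Lp. \<forall>x. frac_maximal \<rho> f x
              \<le> ennreal C * epow (HL_maximal f x) (p / q) * epow (morrey_norm p \<phi> f) (1 - p / q)) \<and>
           (p > 1 \<longrightarrow> (\<forall>f\<in>wLp. \<forall>x. frac_maximal \<rho> f x
              \<le> ennreal C * epow (HL_maximal f x) (p / q) * epow (weak_morrey_norm p \<phi> f) (1 - p / q)))) \<and>
        bounded_operator M\<^sub>\<rho> Lp (morrey_norm p \<phi>) wLq (weak_morrey_norm q \<phi>) \<and>
        (p > 1 \<longrightarrow>
           bounded_operator M\<^sub>\<rho> Lp (morrey_norm p \<phi>) Lq (morrey_norm q \<phi>) \<and>
           bounded_operator M\<^sub>\<rho> wLp (weak_morrey_norm p \<phi>) wLq (weak_morrey_norm q \<phi>)))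
     \<and> (bounded_operator M\<^sub>\<rho> Lp (morrey_norm p \<phi>) wLq (weak_morrey_norm q \<phi>) \<longrightarrow>
          (\<exists>A>0. sup_condition p q \<phi> \<rho> A))
     \<and> (bounded_operator M\<^sub>\<rho> Lp (morrey_norm p \<phi>) L1 (morrey_norm 1 (\<lambda>r. \<phi> r powr (1 / q))) \<longrightarrow>
          (\<exists>A>0. sup_condition p q \<phi> \<rho> A))"
proof -
  have pos: "\<And>r. 0 < r \<Longrightarrow> 0 < \<phi> r" using phi by (simp add: G_dec_def)
  have "0 < q" using pq by simp
  have Lp: "f \<in> borel_measurable lebesgue" "morrey_norm p \<phi> f < \<infinity>" if "f \<in> Lp" for f
    using that unfolding Lp_def morrey_def by blast+
  have wLp: "f \<in> borel_measurable lebesgue" "weak_morrey_norm p \<phi> f < \<infinity>" if "f \<in> wLp" for f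
    using that unfolding wLp_def weak_morrey_def by blast+
  define \<kappa> where "\<kappa> = 2 / (1 - 2 powr (1 - p))"
  have \<kappa>: "0 < \<kappa>" if "1 < p" using geometric_tail[OF that] by (simp add: \<kappa>_def)
  have tail_strong: "tail_bound p \<phi> 1 N f" if "f \<in> Lp" "0 \<le> N" "morrey_norm p \<phi> f \<le> ennreal N" for f N
    using that pq pos Lp by (intro tail_bound_strong) auto
  have tail_weak: "tail_bound p \<phi> \<kappa> N f"
    if "1 < p" "f \<in> wLp" "0 \<le> N" "weak_morrey_norm p \<phi> f \<le> ennreal N" for f N
    unfolding \<kappa>_def using that pos wLp by (intro tail_bound_weak) auto
  have direct: "\<exists>C::real. C > 0 \<and>
      (\<forall>f\<in>Lp. \<forall>x. frac_maximal \<rho> f x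
        \<le> ennreal C * epow (HL_maximal f x) (p / q) * epow (morrey_norm p \<phi> f) (1 - p / q)) \<and>
      (p > 1 \<longrightarrow> (\<forall>f\<in>wLp. \<forall>x. frac_maximal \<rho> f x
        \<le> ennreal C * epow (HL_maximal f x) (p / q) * epow (weak_morrey_norm p \<phi> f) (1 - p / q)))"
    if A: "0 < A" "sup_condition p q \<phi> \<rho> A" for A
  proof -
    define C where "C = (\<lambda>\<kappa>. A * (1 + \<kappa>) powr (1 - p / q))"
    have pointwise: "frac_maximal \<rho> f x \<le> ennreal (max (C 1) (C \<kappa>))
        * epow (HL_maximal f x) (p / q) * epow y (1 - p / q)"
      if meas: "f \<in> borel_measurable lebesgue" and "y < \<infinity>" "k \<in> {1, \<kappa>}" "0 \<le> k"
        and tail: "\<And>N. 0 \<le> N \<Longrightarrow> y \<le> ennreal N \<Longrightarrow> tail_bound p \<phi> k N f" for f x y k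
    proof -
      obtain M where M: "0 \<le> M" "y = ennreal M" using \<open>y < \<infinity>\<close> by (cases y) auto
      have tail': "tail_bound p \<phi> k N f" if "M < N" for N
        using that M by (intro tail) (auto simp: ennreal_leI)
      have "frac_maximal \<rho> f x \<le> ennreal (C k) * epow (HL_maximal f x) (p / q) * epow y (1 - p / q)"
        unfolding C_def M(2)
        by (rule frac_maximal_le_of_tail_bound[OF meas tail' rho pos A(2)]) (use pq A M \<open>0 \<le> k\<close> in auto)
      also have "\<dots> \<le> ennreal (max (C 1) (C \<kappa>)) * epow (HL_maximal f x) (p / q) * epow y (1 - p / q)"
        using \<open>k \<in> {1, \<kappa>}\<close> by (intro mult_right_mono ennreal_leI) auto
      finally show ?thesis .
    qed
    show ?thesis
    proof (intro exI[of _ "max (C 1) (C \<kappa>)"] conjI ballI allI impI)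
      show "0 < max (C 1) (C \<kappa>)" using A by (simp add: C_def less_max_iff_disj)
      show "frac_maximal \<rho> f x \<le> ennreal (max (C 1) (C \<kappa>)) * epow (HL_maximal f x) (p / q)
          * epow (morrey_norm p \<phi> f) (1 - p / q)" if "f \<in> Lp" for f x
        using that Lp tail_strong by (intro pointwise[of f "morrey_norm p \<phi> f" 1]) auto
      show "frac_maximal \<rho> f x \<le> ennreal (max (C 1) (C \<kappa>)) * epow (HL_maximal f x) (p / q)
          * epow (weak_morrey_norm p \<phi> f) (1 - p / q)" if "1 < p" "f \<in> wLp" for f x
        using that wLp tail_weak \<kappa> by (intro pointwise[of f "weak_morrey_norm p \<phi> f" \<kappa>]) auto
    qed
  qed
  have strong_weak: "bounded_operator M\<^sub>\<rho> Lp (morrey_norm p \<phi>) wLq (weak_morrey_norm q \<phi>)"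
    if "0 < A" "sup_condition p q \<phi> \<rho> A" for A
    unfolding M\<^sub>\<rho>_def wLq_def
    by (rule bounded_operator_weak_morreyI[OF Lp tail_strong phi rho that(2) pq that(1)]) auto
  have strong_strong: "bounded_operator M\<^sub>\<rho> Lp (morrey_norm p \<phi>) Lq (morrey_norm q \<phi>)"
    if "0 < A" "sup_condition p q \<phi> \<rho> A" "1 < p" for A
    unfolding M\<^sub>\<rho>_def Lp_def Lq_def
    by (rule bounded_operator_morreyI[OF phi rho that(2,3) pq(2) that(1)])
  have weak_weak: "bounded_operator M\<^sub>\<rho> wLp (weak_morrey_norm p \<phi>) wLq (weak_morrey_norm q \<phi>)"
    if "0 < A" "sup_condition p q \<phi> \<rho> A" "1 < p" for A
    unfolding M\<^sub>\<rho>_def wLq_def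
    by (rule bounded_operator_weak_morreyI[OF wLp tail_weak phi rho that(2) pq that(1)])
      (use \<kappa> that in auto)
  have ii: "\<exists>A>0. sup_condition p q \<phi> \<rho> A"
    if "bounded_operator M\<^sub>\<rho> Lp (morrey_norm p \<phi>) wLq (weak_morrey_norm q \<phi>)"
  proof (rule sup_condition_of_bounded[OF pq(1) phi])
    show "bounded_operator (frac_maximal_op \<rho>) (morrey p \<phi>) (morrey_norm p \<phi>) wLq (weak_morrey_norm q \<phi>)"
      using that unfolding M\<^sub>\<rho>_def Lp_def .
  qed (fact rho, rule rho_le_of_weak_morrey_norm[OF \<open>0 < q\<close> pos rho])
  have iii: "\<exists>A>0. sup_condition p q \<phi> \<rho> A"
    if "bounded_operator M\<^sub>\<rho> Lp (morrey_norm p \<phi>) L1 (morrey_norm 1 (\<lambda>r. \<phi> r powr (1 / q)))"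
  proof (rule sup_condition_of_bounded[OF pq(1) phi])
    show "bounded_operator (frac_maximal_op \<rho>) (morrey p \<phi>) (morrey_norm p \<phi>) L1
        (morrey_norm 1 (\<lambda>r. \<phi> r powr (1 / q)))"
      using that unfolding M\<^sub>\<rho>_def Lp_def .
    fix r t N :: real
    assume *: "0 < t" "t \<le> r" "0 < N" "morrey_norm 1 (\<lambda>r. \<phi> r powr (1 / q))
      (frac_maximal_op \<rho> (indicator (ball (0 :: real ^ 'n) r))) \<le> ennreal N"
    have "\<rho> t \<le> N * \<phi> r powr (1 / q)"
      by (rule rho_le_of_morrey_norm_1[OF _ rho *]) (use pos in \<open>simp add: less_imp_neq[symmetric]\<close>)
    also have "\<dots> \<le> 2 * N * \<phi> r powr (1 / q)"
      using \<open>0 < N\<close> by (intro mult_right_mono) auto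
    finally show "\<rho> t \<le> 2 * N * \<phi> r powr (1 / q)" .
  qed (fact rho)
  show ?thesis
    using direct strong_weak strong_strong weak_weak ii iii by blast
qed

end
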